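(* Let $L$ be a simple planar lattice whose poset $P$ of join-irreducible elements has the single diagonal $x\gtrdot y$ with respect to a canonical chain decomposition of $P$. Then the following conditions are equivalent: (a) $L$ is level; (b) $\operatorname{height}(x)+\operatorname{depth}(y)\le\operatorname{rank}\hat P+1$; (c) either $\operatorname{depth}(y)=\operatorname{depth}(x)+1$ or $\operatorname{height}(x)=\operatorname{height}(y)+1$.
   Context: $L$ is a finite distributive lattice and $P$ is its subposet of join-irreducible elements ($\alpha\in L$ is join-irreducible if $\alpha\ne\min L$ and $\alpha=\beta\vee\gamma$ implies $\alpha=\beta$ or $\alpha=\gamma$); $L$ is isomorphic to the lattice of poset ideals (down-sets) of $P$. A canonical chain decomposition of $P$ is a decomposition of the set $P$ into pairwise disjoint chains $C_1,\dots,C_d$, each a maximal (with respect to inclusion) chain of $P$. The simple planar lattices are exactly the finite distributive lattices for which $P$ has a canonical chain decomposition $C_1\cup C_2$ into $d=2$ chains. $x\gtrdot y$ means that $x$ covers $y$: $x>y$ and there is no $z\in P$ with $x>z>y$. A diagonal of $P$ with respect to a canonical chain decomposition is a covering relation $x\gtrdot y$ in $P$ with $x$ and $y$ in different chains of the decomposition. $\hat P=P\cup\{-\infty,\infty\}$ with $-\infty<x<\infty$ for all $x\in P$. The length of a chain $C$ is $|C|-1$; $\operatorname{rank}\hat P$ is the maximal length of a chain in $\hat P$; $\operatorname{height}(x)$ (resp. $\operatorname{depth}(x)$) is the maximal length of a chain in $\hat P$ descending (resp. ascending) from $x$. The "either ... or" in (c) is inclusive. For a field $K$, the Hibi ring $K[L]$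 is the $K$-algebra generated by the elements $\alpha\in L$ with defining relations $\alpha\beta=(\alpha\wedge\beta)(\alpha\vee\beta)$; it is a standard graded Cohen–Macaulay domain. $L$ is level if the canonical module of $K[L]$ is generated in a single degree (independent of $K$). Known combinatorial description: let $\mathcal S(\hat P)$ be the set of maps $v:\hat P\to\mathbb Z_{\ge0}$ with $v(\infty)=0$ and $v(x)\le v(y)$ whenever $x\ge y$, and $\mathcal T(\hat P)$ the set of maps $v:\hat P\to\mathbb Z_{\ge0}$ with $v(\infty)=0$ and $v(x)<v(y)$ whenever $x>y$. The monomials $s^{v(-\infty)}\prod_{x\in P}t_x^{v(x)}$, of degree $v(-\infty)$, with $v\in\mathcal S(\hat P)$ form a $K$-basis of $K[L]$, those with $v\in\mathcal T(\hat P)$ form a $K$-basis of its canonical module, and $\min\{v(-\infty):v\in\mathcal T(\hat P)\}=\operatorname{rank}\hat P$. Hence $L$ is level if and only if for every $v\in\mathcal T(\hat P)$ there is $v'\in\mathcal T(\hat P)$ with $v'(-\infty)=\operatorname{rank}\hat P$ and $v-v'\in\mathcal S(\hat P)$. *)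

theory Defs
  imports Complex_Main "HOL-Library.Poly_Mapping" "HOL-Library.Extended" "HOL-Library.Disjoint_Sets"
begin

section \<open>Chains, height, depth and rank\<close>

definition maximal_chain :: "'b::order set \<Rightarrow> 'b set \<Rightarrow> bool" where
  "maximal_chain P C \<longleftrightarrow> C \<subseteq> P \<and> Complete_Partial_Order.chain (\<le>) C \<and>
     (\<forall>D. D \<subseteq> P \<and> Complete_Partial_Order.chain (\<le>) D \<and> C \<subseteq> D \<longrightarrow> D = C)"

definition canonical_chain_decomposition :: "'b::order set \<Rightarrow> 'b set set \<Rightarrow> bool" where
  "canonical_chain_decomposition P \<C> \<longleftrightarrow> partition_on P \<C> \<and> (\<forall>C\<in>\<C>. maximal_chain P C)"

definition covers_in :: "'b::order set \<Rightarrow> 'b \<Rightarrow> 'b \<Rightarrow> bool" where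
  "covers_in P x y \<longleftrightarrow> x \<in> P \<and> y \<in> P \<and> y < x \<and> (\<nexists>z. z \<in> P \<and> y < z \<and> z < x)"

text \<open>A pair \<open>(x, y)\<close> stands for the covering relation in which \<open>x\<close> is the upper element.\<close>

definition diagonals :: "'b::order set \<Rightarrow> 'b set set \<Rightarrow> ('b \<times> 'b) set" where
  "diagonals P \<C> = {(x, y). covers_in P x y \<and> (\<exists>C\<in>\<C>. \<exists>D\<in>\<C>. C \<noteq> D \<and> x \<in> C \<and> y \<in> D)}"

definition chain_length :: "'b set \<Rightarrow> nat" where
  "chain_length C = card C - 1"

text \<open>The following three notions are meant for a finite poset \<open>Q\<close> (and \<open>z \<in> Q\<close>), so that
  the maxima are taken over finite nonempty sets.\<close>

definition rank :: "'b::order set \<Rightarrow> nat" where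
  "rank Q = Max {chain_length C | C. C \<subseteq> Q \<and> C \<noteq> {} \<and> Complete_Partial_Order.chain (\<le>) C}"

definition height :: "'b::order set \<Rightarrow> 'b \<Rightarrow> nat" where
  "height Q z = Max {chain_length C | C.
     C \<subseteq> Q \<and> Complete_Partial_Order.chain (\<le>) C \<and> z \<in> C \<and> (\<forall>w\<in>C. w \<le> z)}"

definition depth :: "'b::order set \<Rightarrow> 'b \<Rightarrow> nat" where
  "depth Q z = Max {chain_length C | C.
     C \<subseteq> Q \<and> Complete_Partial_Order.chain (\<le>) C \<and> z \<in> C \<and> (\<forall>w\<in>C. z \<le> w)}"


section \<open>Join-irreducible elements\<close>

text \<open>A finite distributive lattice is a type of class \<open>{finite, distrib_lattice}\<close>; its least
  element is \<open>Inf_fin UNIV\<close>.\<close>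

definition join_irreducibles :: "'a::{finite, distrib_lattice} set" where
  "join_irreducibles =
     {\<alpha>. \<alpha> \<noteq> Inf_fin UNIV \<and> (\<forall>\<beta> \<gamma>. \<alpha> = sup \<beta> \<gamma> \<longrightarrow> \<alpha> = \<beta> \<or> \<alpha> = \<gamma>)}"

definition hat :: "'b set \<Rightarrow> 'b extended set" where
  "hat P = {Minf, Pinf} \<union> Fin ` P"

abbreviation P_hat :: "'a::{finite, distrib_lattice} extended set" where
  "P_hat \<equiv> hat join_irreducibles"

definition simple_planar :: "'a::{finite, distrib_lattice} itself \<Rightarrow> bool" where
  "simple_planar L \<longleftrightarrow>
     (\<exists>\<C>. canonical_chain_decomposition (join_irreducibles :: 'a set) \<C> \<and> card \<C> = 2)"


section \<open>The Hibi ring\<close>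

text \<open>\<open>('i, 'k) polys\<close> is the polynomial ring over \<open>'k\<close> in indeterminates indexed by \<open>'i\<close>:
  finitely supported functions from exponent vectors to coefficients, with convolution.\<close>

type_synonym ('i, 'k) polys = "('i \<Rightarrow>\<^sub>0 nat) \<Rightarrow>\<^sub>0 'k"

definition Var :: "'i \<Rightarrow> ('i, 'k::comm_ring_1) polys" where
  "Var i = Poly_Mapping.single (Poly_Mapping.single i 1) 1"

definition Const :: "'k \<Rightarrow> ('i, 'k::comm_ring_1) polys" where
  "Const c = Poly_Mapping.single 0 c"

definition hibi_relations :: "('a::{finite, distrib_lattice}, 'k::field) polys set" where
  "hibi_relations = {Var \<alpha> * Var \<beta> - Var (inf \<alpha> \<beta>) * Var (sup \<alpha> \<beta>) | \<alpha> \<beta>. True}"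

definition hibi_ideal :: "('a::{finite, distrib_lattice}, 'k::field) polys set" where
  "hibi_ideal = module.span (*) hibi_relations"

lemma module_mult: "module ((*) :: 'r::comm_ring_1 \<Rightarrow> 'r \<Rightarrow> 'r)"
  by unfold_locales (simp_all add: algebra_simps)

lemma hibi_ideal_zero: "0 \<in> hibi_ideal"
  and hibi_ideal_add: "f \<in> hibi_ideal \<Longrightarrow> g \<in> hibi_ideal \<Longrightarrow> f + g \<in> hibi_ideal"
  and hibi_ideal_diff: "f \<in> hibi_ideal \<Longrightarrow> g \<in> hibi_ideal \<Longrightarrow> f - g \<in> hibi_ideal"
  and hibi_ideal_mult: "f \<in> hibi_ideal \<Longrightarrow> h * f \<in> hibi_ideal"
  unfolding hibi_ideal_def
  using module.span_zero[OF module_mult] module.span_add[OF module_mult]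
    module.span_diff[OF module_mult] module.span_scale[OF module_mult] by blast+

text \<open>The usual embedding of \<open>K[L]\<close> in a polynomial ring sends \<open>\<alpha>\<close> to
  \<open>s \<Prod>\<^sub>x t\<^sub>x\<close>, the product being over the join-irreducible \<open>x \<le> \<alpha>\<close>; here
  \<open>s\<close> is \<open>Var Minf\<close> and \<open>t\<^sub>x\<close> is \<open>Var (Fin x)\<close>. The exponent
  vector is the indicator of \<open>{Minf}\<close> together with the poset ideal of join-irreducible
  elements that corresponds to \<open>\<alpha>\<close>.\<close>

definition hibi_monomial ::
    "'a::{finite, distrib_lattice} \<Rightarrow> ('a extended, 'k::field) polys" where
  "hibi_monomial \<alpha> = Var Minf * (\<Prod>x\<in>{x\<in>join_irreducibles. x \<le> \<alpha>}. Var (Fin x))"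

definition hibi_subst ::
    "('a::{finite, distrib_lattice}, 'k::field) polys \<Rightarrow> ('a extended, 'k) polys" where
  "hibi_subst f = (\<Sum>m\<in>Poly_Mapping.keys f.
     Const (Poly_Mapping.lookup f m) * (\<Prod>\<alpha>\<in>UNIV. hibi_monomial \<alpha> ^ Poly_Mapping.lookup m \<alpha>))"

lemma hibi_subst_superset:
  assumes "finite A" "Poly_Mapping.keys f \<subseteq> A"
  shows "hibi_subst f = (\<Sum>m\<in>A.
     Const (Poly_Mapping.lookup f m) * (\<Prod>\<alpha>\<in>UNIV. hibi_monomial \<alpha> ^ Poly_Mapping.lookup m \<alpha>))"
  unfolding hibi_subst_def
  by (rule sum.mono_neutral_left[OF assms]) (auto simp: in_keys_iff Const_def)

lemma hibi_subst_zero: "hibi_subst 0 = 0"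
  by (simp add: hibi_subst_def)

lemma hibi_subst_add: "hibi_subst (f + g) = hibi_subst f + hibi_subst g"
proof -
  let ?A = "Poly_Mapping.keys f \<union> Poly_Mapping.keys g"
  have A: "finite ?A" "Poly_Mapping.keys f \<subseteq> ?A" "Poly_Mapping.keys g \<subseteq> ?A"
      "Poly_Mapping.keys (f + g) \<subseteq> ?A"
    using Poly_Mapping.keys_add[of f g] by auto
  show ?thesis
    unfolding hibi_subst_superset[OF A(1,2)] hibi_subst_superset[OF A(1,3)]
      hibi_subst_superset[OF A(1,4)] sum.distrib[symmetric]
    by (rule sum.cong) (simp_all add: lookup_add Const_def single_add algebra_simps)
qed

lemma hibi_subst_uminus: "hibi_subst (- f) = - hibi_subst f"
  using hibi_subst_add[of f "- f"] by (simp add: hibi_subst_zero eq_neg_iff_add_eq_0 add.commute)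

lemma hibi_subst_diff: "hibi_subst (f - g) = hibi_subst f - hibi_subst g"
  using hibi_subst_add[of f "- g"] by (simp add: hibi_subst_uminus)

lemma hibi_subst_single:
  "hibi_subst (Poly_Mapping.single m c) =
     Const c * (\<Prod>\<alpha>\<in>UNIV. hibi_monomial \<alpha> ^ Poly_Mapping.lookup m \<alpha>)"
  by (subst hibi_subst_superset[of "{m}"]) simp_all

lemma hibi_subst_one: "hibi_subst 1 = 1"
  using hibi_subst_single[of 0 1] by (simp add: Const_def)

lemma polys_induct:
  fixes f :: "('i, 'k::comm_ring_1) polys"
  assumes "Q 0" "\<And>m c. Q (Poly_Mapping.single m c)"
    and "\<And>f g. Q f \<Longrightarrow> Q g \<Longrightarrow> Q (f + g)"
  shows "Q f"
proof -
  have f: "f = (\<Sum>m\<in>Poly_Mapping.keys f. Poly_Mapping.single m (Poly_Mapping.lookup f m))"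
    by (rule poly_mapping_eqI)
      (auto simp: lookup_sum lookup_single when_def in_keys_iff)
  have "Q (\<Sum>m\<in>A. Poly_Mapping.single m (Poly_Mapping.lookup f m))" if "finite A" for A
    using that by (induction A) (auto intro: assms)
  then show ?thesis by (subst f) simp
qed

lemma hibi_subst_mult: "hibi_subst (f * g) = hibi_subst f * hibi_subst g"
proof (induction f rule: polys_induct)
  case (2 m c)
  have Const_mult: "Const (a * b) = Const a * (Const b :: ('a extended, 'b) polys)" for a b
    by (simp add: Const_def mult_single)
  show ?case
  proof (induction g rule: polys_induct)
    case (2 n b)
    show ?case
      by (simp add: mult_single hibi_subst_single lookup_add power_add prod.distrib Const_mult mult_ac)
  qed (simp_all add: hibi_subst_zero hibi_subst_add distrib_left)
qed (simp_all add: hibi_subst_zero hibi_subst_add distrib_right)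

lemma hibi_subst_Var: "hibi_subst (Var \<alpha>) = hibi_monomial \<alpha>"
proof -
  have "(\<Prod>\<beta>\<in>UNIV. hibi_monomial \<beta> ^ Poly_Mapping.lookup (Poly_Mapping.single \<alpha> 1) \<beta>)
      = (\<Prod>\<beta>\<in>UNIV. if \<beta> = \<alpha> then hibi_monomial \<beta> else (1 :: ('a extended, 'b) polys))"
    by (rule prod.cong) (auto simp: lookup_single)
  then show ?thesis
    by (simp add: Var_def hibi_subst_single Const_def)
qed

lemma join_irreducible_le_sup:
  fixes x :: "'a::{finite, distrib_lattice}"
  assumes "x \<in> join_irreducibles" "x \<le> sup \<alpha> \<beta>"
  shows "x \<le> \<alpha> \<or> x \<le> \<beta>"
proof -
  have "x = sup (inf x \<alpha>) (inf x \<beta>)"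
    using assms(2) by (metis inf.absorb1 inf_sup_distrib1)
  moreover have "\<forall>\<beta> \<gamma>. x = sup \<beta> \<gamma> \<longrightarrow> x = \<beta> \<or> x = \<gamma>"
    using assms(1) by (simp add: join_irreducibles_def)
  ultimately have "x = inf x \<alpha> \<or> x = inf x \<beta>"
    by blast
  then show ?thesis unfolding inf.order_iff .
qed

lemma hibi_monomial_mult:
  "hibi_monomial \<alpha> * hibi_monomial \<beta> = hibi_monomial (inf \<alpha> \<beta>) * hibi_monomial (sup \<alpha> \<beta>)"
proof -
  let ?I = "\<lambda>\<alpha>. {x \<in> join_irreducibles. x \<le> (\<alpha>::'a)}"
  have 1: "?I (inf \<alpha> \<beta>) = ?I \<alpha> \<inter> ?I \<beta>" by auto
  have 2: "?I (sup \<alpha> \<beta>) = ?I \<alpha> \<union> ?I \<beta>"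
    using join_irreducible_le_sup[of _ \<alpha> \<beta>] by (auto simp: le_supI1 le_supI2)
  have "prod (\<lambda>x. Var (Fin x)) (?I (sup \<alpha> \<beta>)) * prod (\<lambda>x. Var (Fin x)) (?I (inf \<alpha> \<beta>))
      = prod (\<lambda>x. Var (Fin x) :: ('a extended, 'b) polys) (?I \<alpha>) * prod (\<lambda>x. Var (Fin x)) (?I \<beta>)"
    unfolding 1 2 by (rule prod.union_inter) auto
  then show ?thesis
    by (simp add: hibi_monomial_def mult_ac)
qed

lemma hibi_subst_hibi_ideal: "f \<in> hibi_ideal \<Longrightarrow> hibi_subst f = 0"
  unfolding hibi_ideal_def
proof (induction rule: module.span_induct[OF module_mult, consumes 1])
  case 1
  show ?case
    by (auto simp: module.subspace_def[OF module_mult] hibi_subst_zero hibi_subst_add hibi_subst_mult)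
next
  case (2 f)
  then obtain \<alpha> \<beta> where f: "f = Var \<alpha> * Var \<beta> - Var (inf \<alpha> \<beta>) * Var (sup \<alpha> \<beta>)"
    by (auto simp: hibi_relations_def)
  show ?case
    unfolding f hibi_subst_diff hibi_subst_mult hibi_subst_Var
    using hibi_monomial_mult[of \<alpha> \<beta>] by simp
qed

text \<open>The Hibi ring \<open>K[L]\<close>, given by generators \<open>\<alpha> \<in> L\<close> and the relations
  \<open>\<alpha> \<beta> = (\<alpha> \<sqinter> \<beta>) (\<alpha> \<squnion> \<beta>)\<close>.\<close>

definition hibi_eq ::
  "('a::{finite, distrib_lattice}, 'k::field) polys \<Rightarrow> ('a, 'k) polys \<Rightarrow> bool" where
  "hibi_eq f g \<longleftrightarrow> f - g \<in> hibi_ideal"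

lemma hibi_eq_equivp:
  "equivp (hibi_eq :: ('a::{finite, distrib_lattice}, 'k::field) polys \<Rightarrow> _)" (is "equivp ?R")
proof (rule equivpI)
  show "reflp ?R"
    by (auto simp: reflp_def hibi_eq_def hibi_ideal_zero)
  show "symp ?R"
  proof (rule sympI)
    fix f g :: "('a, 'k) polys"
    assume "hibi_eq f g"
    then have "0 - (f - g) \<in> hibi_ideal"
      unfolding hibi_eq_def by (rule hibi_ideal_diff[OF hibi_ideal_zero])
    then show "hibi_eq g f" by (simp add: hibi_eq_def)
  qed
  show "transp ?R"
  proof (rule transpI)
    fix f g h :: "('a, 'k) polys"
    assume "hibi_eq f g" "hibi_eq g h"
    then have "(f - g) + (g - h) \<in> hibi_ideal"
      unfolding hibi_eq_def by (rule hibi_ideal_add)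
    then show "hibi_eq f h" by (simp add: hibi_eq_def)
  qed
qed

quotient_type (overloaded) ('a, 'k) hibi_ring =
  "('a::{finite, distrib_lattice}, 'k::field) polys" / hibi_eq
  by (rule hibi_eq_equivp)

instantiation hibi_ring :: ("{finite, distrib_lattice}", field) comm_ring_1
begin

lift_definition zero_hibi_ring :: "('a, 'b) hibi_ring" is 0 .

lift_definition one_hibi_ring :: "('a, 'b) hibi_ring" is 1 .

lift_definition plus_hibi_ring :: "('a, 'b) hibi_ring \<Rightarrow> ('a, 'b) hibi_ring \<Rightarrow> ('a, 'b) hibi_ring"
  is "(+)"
  unfolding hibi_eq_def by (drule (1) hibi_ideal_add) (simp add: algebra_simps)

lift_definition uminus_hibi_ring :: "('a, 'b) hibi_ring \<Rightarrow> ('a, 'b) hibi_ring"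
  is uminus
  unfolding hibi_eq_def by (drule hibi_ideal_diff[OF hibi_ideal_zero]) (simp add: algebra_simps)

lift_definition minus_hibi_ring :: "('a, 'b) hibi_ring \<Rightarrow> ('a, 'b) hibi_ring \<Rightarrow> ('a, 'b) hibi_ring"
  is "(-)"
  unfolding hibi_eq_def by (drule (1) hibi_ideal_diff) (simp add: algebra_simps)

lift_definition times_hibi_ring :: "('a, 'b) hibi_ring \<Rightarrow> ('a, 'b) hibi_ring \<Rightarrow> ('a, 'b) hibi_ring"
  is "(*)"
proof -
  fix f f' g g' :: "('a, 'b) polys"
  assume "hibi_eq f f'" "hibi_eq g g'"
  then have "g * (f - f') + f' * (g - g') \<in> hibi_ideal"
    unfolding hibi_eq_def by (intro hibi_ideal_add hibi_ideal_mult)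
  then show "hibi_eq (f * g) (f' * g')"
    by (simp add: hibi_eq_def algebra_simps)
qed

instance
proof
  show "(0 :: ('a, 'b) hibi_ring) \<noteq> 1"
  proof transfer
    show "\<not> hibi_eq (0 :: ('a, 'b) polys) 1"
      using hibi_subst_hibi_ideal[of "0 - 1 :: ('a, 'b) polys"]
      by (auto simp: hibi_eq_def hibi_subst_uminus hibi_subst_one)
  qed
qed (transfer; simp add: hibi_eq_def algebra_simps hibi_ideal_zero)+

end

lift_definition hibi_embed ::
    "('a::{finite, distrib_lattice}, 'k::field) hibi_ring \<Rightarrow> ('a extended, 'k) polys"
  is hibi_subst
  unfolding hibi_eq_def by (drule hibi_subst_hibi_ideal) (simp add: hibi_subst_diff)

lemma hibi_embed_add: "hibi_embed (r + r') = hibi_embed r + hibi_embed r'"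
  by transfer (rule hibi_subst_add)

lemma hibi_embed_mult: "hibi_embed (r * r') = hibi_embed r * hibi_embed r'"
  by transfer (rule hibi_subst_mult)

lemma hibi_embed_one: "hibi_embed 1 = 1"
  by transfer (rule hibi_subst_one)

definition hibi_scale ::
    "('a::{finite, distrib_lattice}, 'k::field) hibi_ring
      \<Rightarrow> ('a extended, 'k) polys \<Rightarrow> ('a extended, 'k) polys" where
  "hibi_scale r p = hibi_embed r * p"

lemma module_hibi_scale: "module hibi_scale"
  by unfold_locales
    (simp_all add: hibi_scale_def hibi_embed_add hibi_embed_mult hibi_embed_one algebra_simps)


section \<open>The canonical module and levelness\<close>

text \<open>Exponent vectors on \<open>hat P\<close> are finitely supported functions on \<open>'a extended\<close> that vanish
  off \<open>hat P\<close>.\<close>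

definition T_maps :: "'b::order set \<Rightarrow> ('b extended \<Rightarrow>\<^sub>0 nat) set" where
  "T_maps P = {v. Poly_Mapping.keys v \<subseteq> hat P \<and> Poly_Mapping.lookup v Pinf = 0 \<and>
     (\<forall>x\<in>hat P. \<forall>y\<in>hat P. y < x \<longrightarrow> Poly_Mapping.lookup v x < Poly_Mapping.lookup v y)}"

text \<open>The canonical module of \<open>K[L]\<close>, in its standard monomial description: the \<open>K\<close>-span of
  the monomials with exponent vector in \<open>T_maps\<close>, with \<open>K[L]\<close> acting through \<open>hibi_embed\<close>.
  The degree of a monomial is its exponent at \<open>Minf\<close>, that is, its degree in \<open>s\<close>.\<close>

definition canonical_module :: "('a::{finite, distrib_lattice} extended, 'k::field) polys set" where
  "canonical_module = {p. Poly_Mapping.keys p \<subseteq> T_maps join_irreducibles}"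

definition canonical_module_degree ::
    "nat \<Rightarrow> ('a::{finite, distrib_lattice} extended, 'k::field) polys set" where
  "canonical_module_degree d =
     {p \<in> canonical_module. \<forall>v\<in>Poly_Mapping.keys p. Poly_Mapping.lookup v Minf = d}"

definition S_maps :: "'b::order set \<Rightarrow> ('b extended \<Rightarrow>\<^sub>0 nat) set" where
  "S_maps P = {v. Poly_Mapping.keys v \<subseteq> hat P \<and> Poly_Mapping.lookup v Pinf = 0 \<and>
     (\<forall>x\<in>hat P. \<forall>y\<in>hat P. y \<le> x \<longrightarrow> Poly_Mapping.lookup v x \<le> Poly_Mapping.lookup v y)}"

lemma S_maps_zero: "0 \<in> S_maps P"
  by (simp add: S_maps_def)

lemma S_maps_add: "v \<in> S_maps P \<Longrightarrow> w \<in> S_maps P \<Longrightarrow> v + w \<in> S_maps P"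
  using Poly_Mapping.keys_add[of v w] by (auto simp: S_maps_def lookup_add intro: add_mono)

lemma T_maps_add: "v \<in> S_maps P \<Longrightarrow> w \<in> T_maps P \<Longrightarrow> v + w \<in> T_maps P"
  using Poly_Mapping.keys_add[of v w]
  by (auto simp: S_maps_def T_maps_def lookup_add intro: add_le_less_mono)

lemma prod_Var:
  "finite A \<Longrightarrow> (\<Prod>x\<in>A. Var (g x)) = Poly_Mapping.single (\<Sum>x\<in>A. Poly_Mapping.single (g x) 1) 1"
  by (induction A rule: finite_induct) (simp_all add: Var_def mult_single)

lemma keys_hibi_monomial:
  "Poly_Mapping.keys (hibi_monomial \<alpha> :: ('a::{finite, distrib_lattice} extended, 'k::field) polys)
     \<subseteq> S_maps join_irreducibles"
proof -
  let ?I = "{x \<in> join_irreducibles. x \<le> \<alpha>}"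
  define u :: "'a extended \<Rightarrow>\<^sub>0 nat" where
    "u = Poly_Mapping.single Minf 1 + (\<Sum>x\<in>?I. Poly_Mapping.single (Fin x) 1)"
  have "(hibi_monomial \<alpha> :: ('a extended, 'k) polys) = Poly_Mapping.single u 1"
    unfolding hibi_monomial_def u_def prod_Var[OF finite, of Fin]
    by (simp add: Var_def mult_single)
  moreover have Minf: "Poly_Mapping.lookup u Minf = 1"
    by (simp add: u_def lookup_add lookup_sum lookup_single)
  moreover have Pinf: "Poly_Mapping.lookup u Pinf = 0"
    by (simp add: u_def lookup_add lookup_sum lookup_single)
  moreover have Fin: "Poly_Mapping.lookup u (Fin z) = (if z \<in> ?I then 1 else 0)" for z
    by (simp add: u_def lookup_add lookup_sum lookup_single when_def)
  moreover have "Poly_Mapping.keys u \<subseteq> hat join_irreducibles"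
  proof
    fix z assume "z \<in> Poly_Mapping.keys u"
    then show "z \<in> hat join_irreducibles"
      by (cases z) (auto simp: hat_def in_keys_iff Fin split: if_splits)
  qed
  moreover have "Poly_Mapping.lookup u x \<le> Poly_Mapping.lookup u y"
    if "y \<le> x" "y \<in> hat join_irreducibles" for x y
    using that by (cases x; cases y) (auto simp: Minf Pinf Fin hat_def)
  ultimately show ?thesis
    by (auto simp: S_maps_def)
qed

lemma keys_hibi_embed:
  "Poly_Mapping.keys (hibi_embed r :: ('a::{finite, distrib_lattice} extended, 'k::field) polys)
     \<subseteq> S_maps join_irreducibles"
proof -
  let ?B = "{p :: ('a extended, 'k) polys. Poly_Mapping.keys p \<subseteq> S_maps join_irreducibles}"
  have C: "Const c \<in> ?B" for c
    using S_maps_zero by (auto simp: Const_def)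
  have M: "p * q \<in> ?B" if "p \<in> ?B" "q \<in> ?B" for p q
    using that Poly_Mapping.keys_mult[of p q] by (blast intro: S_maps_add)
  have one: "1 \<in> ?B"
    using C[of 1] by (simp add: Const_def)
  have P: "hibi_monomial \<alpha> ^ n \<in> ?B" for \<alpha> n
  proof (induction n)
    case 0
    show ?case using one by simp
  next
    case (Suc n)
    then show ?case using M[of "hibi_monomial \<alpha>"] keys_hibi_monomial by auto
  qed
  have PP: "(\<Prod>\<alpha>\<in>A. hibi_monomial \<alpha> ^ f \<alpha>) \<in> ?B" if "finite A" for A f
    using that
  proof (induction A)
    case empty
    show ?case using one by simp
  next
    case (insert \<beta> A)
    show ?case
      unfolding prod.insert[OF insert.hyps] by (rule M[OF P insert.IH])
  qed
  have "hibi_subst f \<in> ?B" for f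
  proof (induction f rule: polys_induct)
    case 1
    show ?case by (simp add: hibi_subst_zero)
  next
    case (2 m c)
    show ?case unfolding hibi_subst_single by (rule M[OF C PP]) simp
  next
    case (3 f g)
    then show ?case
      using Poly_Mapping.keys_add[of "hibi_subst f" "hibi_subst g"]
      by (auto simp: hibi_subst_add)
  qed
  then show ?thesis by transfer simp
qed

lemma canonical_module_subspace:
  "module.subspace hibi_scale
     (canonical_module :: ('a::{finite, distrib_lattice} extended, 'k::field) polys set)"
proof (rule module.subspaceI[OF module_hibi_scale])
  show "0 \<in> (canonical_module :: ('a extended, 'k) polys set)"
    by (simp add: canonical_module_def)
next
  fix p q :: "('a extended, 'k) polys"
  assume "p \<in> canonical_module" "q \<in> canonical_module"
  then show "p + q \<in> canonical_module"
    using Poly_Mapping.keys_add[of p q] by (auto simp: canonical_module_def)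
next
  fix r :: "('a, 'k) hibi_ring" and p :: "('a extended, 'k) polys"
  assume "p \<in> canonical_module"
  then show "hibi_scale r p \<in> canonical_module"
    using Poly_Mapping.keys_mult[of "hibi_embed r" p] keys_hibi_embed[of r]
    by (force simp: canonical_module_def hibi_scale_def intro: T_maps_add)
qed

text \<open>The left-hand side is the \<open>K[L]\<close>-submodule generated by the elements of degree \<open>d\<close>.\<close>

definition level :: "'k::field itself \<Rightarrow> 'a::{finite, distrib_lattice} itself \<Rightarrow> bool" where
  "level K L \<longleftrightarrow>
     (\<exists>d. module.span (hibi_scale :: ('a, 'k) hibi_ring \<Rightarrow> _) (canonical_module_degree d)
          = canonical_module)"

end

theory Submission
  imports Defs
begin

text \<open>Every order-reversing map is the exponent vector of a product of generators of \<open>K[L]\<close>, so \<open>L\<close> is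
  level iff every \<open>v\<close> in \<open>T_maps\<close> can be lowered, by an element of \<open>S_maps\<close>, to a map in
  \<open>T_maps\<close> whose value at the bottom is the rank. For (b) implies (a), a map \<open>v\<close> of larger degree is
  lowered by the indicator of a down-set \<open>I\<close>; this works iff \<open>v\<close> drops by at least 2 along every
  step out of \<open>I\<close>. The smallest candidate \<open>I\<close> contains the top only if \<open>v\<close> drops by exactly 1 along a
  path from the bottom to \<open>x\<close> and along one from \<open>y\<close> to the top, and then
  \<open>v Minf \<le> height x + depth y - 1 \<le> rank\<close>. For (a) implies (b), the map which is tight
  along both of these paths cannot be lowered. For (b) iff (c), every chain can be extended by \<open>x\<close> or by
  \<open>y\<close>, so the rank is the larger one of \<open>height x + depth x\<close> and \<open>height y + depth y\<close>.\<close>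

section \<open>Longest chains in intervals\<close>

text \<open>Both endpoints are forced into the chain, so that \<open>height\<close>,
  \<open>depth\<close> and \<open>rank\<close> become the cases in which one or both endpoints are
  the bounds of the poset. A chain of this kind exists only if \<open>a \<le> b\<close>.\<close>

definition longest :: "'b::order set \<Rightarrow> 'b \<Rightarrow> 'b \<Rightarrow> nat" where
  "longest Q a b = Max {chain_length C | C. C \<subseteq> Q \<and> Complete_Partial_Order.chain (\<le>) C \<and>
     a \<in> C \<and> b \<in> C \<and> (\<forall>w\<in>C. a \<le> w \<and> w \<le> b)}"

text \<open>The order condition of \<open>T_maps\<close> for plain functions, so that it applies to
  \<open>depth\<close> and \<open>lifted_depth\<close> before they are packed as finitely supported
  exponent vectors.\<close>

definition strict_antitone_on :: "'b::order set \<Rightarrow> ('b \<Rightarrow> nat) \<Rightarrow> bool" where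
  "strict_antitone_on Q v \<longleftrightarrow> (\<forall>x\<in>Q. \<forall>y\<in>Q. y < x \<longrightarrow> v x < v y)"

lemma strict_antitone_onD:
  "strict_antitone_on Q v \<Longrightarrow> y < x \<Longrightarrow> x \<in> Q \<Longrightarrow> y \<in> Q \<Longrightarrow> v x < v y"
  by (simp add: strict_antitone_on_def)

lemma finite_chain_lengths: "finite Q \<Longrightarrow> finite {chain_length C | C. C \<subseteq> Q \<and> R C}"
  by (rule finite_subset[of _ "chain_length ` Pow Q"]) auto

text \<open>Adjoining \<open>a\<close> and \<open>b\<close> to \<open>K\<close> gives a chain that
  competes in the maximum; the \<open>+ 1\<close> appears because \<open>chain_length\<close> is the
  cardinality minus 1.\<close>

lemma card_chain_le_longest:
  fixes Q :: "'b::order set"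
  assumes "finite Q" "a \<in> Q" "b \<in> Q" "a \<le> b"
    and "K \<subseteq> Q" "Complete_Partial_Order.chain (\<le>) K" "\<And>w. w \<in> K \<Longrightarrow> a \<le> w \<and> w \<le> b"
  shows "card K \<le> longest Q a b + 1"
proof -
  let ?C = "insert a (insert b K)"
  have "?C \<subseteq> Q \<and> Complete_Partial_Order.chain (\<le>) ?C \<and> a \<in> ?C \<and> b \<in> ?C \<and>
      (\<forall>w\<in>?C. a \<le> w \<and> w \<le> b)"
    using assms unfolding chain_def by blast
  then have "chain_length ?C \<le> longest Q a b"
    unfolding longest_def by (intro Max_ge finite_chain_lengths[OF assms(1)]) blast
  moreover have "card K \<le> card ?C"
    using finite_subset[OF assms(5,1)] by (intro card_mono) auto
  ultimately show ?thesis
    by (simp add: chain_length_def)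
qed

lemma longest_attained:
  fixes Q :: "'b::order set"
  assumes "finite Q" "a \<in> Q" "b \<in> Q" "a \<le> b"
  obtains C where "C \<subseteq> Q" "Complete_Partial_Order.chain (\<le>) C" "a \<in> C" "b \<in> C"
    "\<And>w. w \<in> C \<Longrightarrow> a \<le> w \<and> w \<le> b" "finite C" "card C = longest Q a b + 1"
proof -
  have "longest Q a b \<in> {chain_length C | C. C \<subseteq> Q \<and> Complete_Partial_Order.chain (\<le>) C \<and>
     a \<in> C \<and> b \<in> C \<and> (\<forall>w\<in>C. a \<le> w \<and> w \<le> b)}"
    unfolding longest_def
  proof (intro Max_in finite_chain_lengths[OF assms(1)])
    have "{a, b} \<subseteq> Q \<and> Complete_Partial_Order.chain (\<le>) {a, b} \<and> a \<in> {a, b} \<and> b \<in> {a, b} \<and>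
        (\<forall>w\<in>{a, b}. a \<le> w \<and> w \<le> b)"
      using assms by (auto simp: chain_def)
    then show "{chain_length C | C. C \<subseteq> Q \<and> Complete_Partial_Order.chain (\<le>) C \<and>
        a \<in> C \<and> b \<in> C \<and> (\<forall>w\<in>C. a \<le> w \<and> w \<le> b)} \<noteq> {}"
      by blast
  qed
  then obtain C where C: "longest Q a b = chain_length C" "C \<subseteq> Q"
      "Complete_Partial_Order.chain (\<le>) C" "a \<in> C" "b \<in> C" "\<forall>w\<in>C. a \<le> w \<and> w \<le> b"
    by blast
  have "finite C"
    using C(2) assms(1) by (rule finite_subset)
  moreover from this have "card C \<noteq> 0"
    using C(4) by auto
  then have "card C = longest Q a b + 1"
    using C(1) by (simp add: chain_length_def)
  ultimately show thesis
    using C that by blast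
qed

lemma longest_self [simp]:
  fixes Q :: "'b::order set"
  assumes "finite Q" "a \<in> Q"
  shows "longest Q a a = 0"
proof -
  obtain C where "a \<in> C" "\<And>w. w \<in> C \<Longrightarrow> a \<le> w \<and> w \<le> a" "card C = longest Q a a + 1"
    using longest_attained[OF assms(1,2,2) order_refl] by metis
  then have "C = {a}" by force
  with \<open>card C = _\<close> show ?thesis by simp
qed

lemma longest_pos:
  fixes Q :: "'b::order set"
  assumes "finite Q" "a \<in> Q" "b \<in> Q" "a < b"
  shows "1 \<le> longest Q a b"
proof -
  have "card {a, b} \<le> longest Q a b + 1"
    using assms by (intro card_chain_le_longest) (auto simp: chain_def)
  with assms(4) show ?thesis by auto
qed

text \<open>Two longest chains meet only in \<open>b\<close>, and their union is a chain from
  \<open>a\<close> to \<open>c\<close>.\<close>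

lemma longest_superadditive:
  fixes Q :: "'b::order set"
  assumes Q: "finite Q" "a \<in> Q" "b \<in> Q" "c \<in> Q" and le: "a \<le> b" "b \<le> c"
  shows "longest Q a b + longest Q b c \<le> longest Q a c"
proof -
  obtain C where C: "C \<subseteq> Q" "Complete_Partial_Order.chain (\<le>) C" "b \<in> C"
    "\<And>w. w \<in> C \<Longrightarrow> a \<le> w \<and> w \<le> b" "finite C" "card C = longest Q a b + 1"
    using longest_attained[OF Q(1,2,3) le(1)] by metis
  obtain D where D: "D \<subseteq> Q" "Complete_Partial_Order.chain (\<le>) D" "b \<in> D"
    "\<And>w. w \<in> D \<Longrightarrow> b \<le> w \<and> w \<le> c" "finite D" "card D = longest Q b c + 1"
    using longest_attained[OF Q(1,3,4) le(2)] by metis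
  have "C \<inter> D = {b}"
    using C(3,4) D(3,4) by force
  then have "card (C \<union> D) + 1 = card C + card D"
    using card_Un_Int[OF C(5) D(5)] by simp
  have "Complete_Partial_Order.chain (\<le>) (C \<union> D)"
    using C(2,4) D(2,4) unfolding chain_def by (metis Un_iff order_trans)
  moreover have "a \<le> w \<and> w \<le> c" if "w \<in> C \<union> D" for w
    using that C(4) D(4) le by (metis Un_iff order_trans)
  ultimately have "card (C \<union> D) \<le> longest Q a c + 1"
    using Q le C(1) D(1) by (intro card_chain_le_longest) (auto intro: order_trans)
  with \<open>card (C \<union> D) + 1 = _\<close> show ?thesis
    using C(6) D(6) by simp
qed

text \<open>Cut \<open>K\<close> at \<open>b\<close>, which may lie outside \<open>K\<close>: it is
  added to the part below and to the part above, and is their only common element.\<close>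

lemma card_chain_le_longest_add:
  fixes Q :: "'b::order set"
  assumes Q: "finite Q" "a \<in> Q" "b \<in> Q" "c \<in> Q" and le: "a \<le> b" "b \<le> c"
    and K: "K \<subseteq> Q" "Complete_Partial_Order.chain (\<le>) K" "\<And>w. w \<in> K \<Longrightarrow> a \<le> w \<and> w \<le> c"
    and comp: "\<And>w. w \<in> K \<Longrightarrow> w \<le> b \<or> b \<le> w"
  shows "card K \<le> longest Q a b + longest Q b c + 1"
proof -
  let ?L = "insert b {w \<in> K. w \<le> b}" and ?U = "insert b {w \<in> K. b \<le> w}"
  have fin: "finite ?L" "finite ?U"
    using finite_subset[OF K(1) Q(1)] by auto
  have "card ?L \<le> longest Q a b + 1"
    using Q le K by (intro card_chain_le_longest) (auto simp: chain_def)
  moreover have "card ?U \<le> longest Q b c + 1"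
    using Q le K by (intro card_chain_le_longest) (auto simp: chain_def)
  moreover have "?L \<inter> ?U = {b}"
    by force
  then have "card (?L \<inter> ?U) = 1"
    by (metis is_singletonI is_singleton_altdef)
  then have "card (?L \<union> ?U) + 1 = card ?L + card ?U"
    using card_Un_Int[OF fin] by linarith
  moreover have "card K \<le> card (?L \<union> ?U)"
    using fin comp by (intro card_mono) auto
  ultimately show ?thesis
    by linarith
qed

text \<open>No chain from \<open>a\<close> to \<open>c\<close> can bypass \<open>b\<close>, so
  \<open>longest_superadditive\<close> becomes an equality.\<close>

lemma longest_split_le:
  fixes Q :: "'b::order set"
  assumes Q: "finite Q" "a \<in> Q" "b \<in> Q" "c \<in> Q" and le: "a \<le> b" "b \<le> c"
    and comp: "\<And>w. w \<in> Q \<Longrightarrow> a \<le> w \<Longrightarrow> w \<le> c \<Longrightarrow> w \<le> b \<or> b \<le> w"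
  shows "longest Q a c \<le> longest Q a b + longest Q b c"
proof -
  obtain C where C: "C \<subseteq> Q" "Complete_Partial_Order.chain (\<le>) C"
    "\<And>w. w \<in> C \<Longrightarrow> a \<le> w \<and> w \<le> c" "card C = longest Q a c + 1"
    using longest_attained[OF Q(1,2,4) order_trans[OF le]] by metis
  have "card C \<le> longest Q a b + longest Q b c + 1"
    using Q le C(1-3) by (intro card_chain_le_longest_add) (use comp in blast)+
  with C(4) show ?thesis by simp
qed

text \<open>Along a longest chain \<open>v\<close> is injective with values between
  \<open>v b\<close> and \<open>v a\<close>. Tightness in the later arguments means equality in this
  bound.\<close>

lemma strict_antitone_on_longest:
  fixes Q :: "'b::order set"
  assumes v: "strict_antitone_on Q v" and Q: "finite Q" "a \<in> Q" "b \<in> Q" "a \<le> b"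
  shows "v b + longest Q a b \<le> v a"
proof -
  obtain C where C: "C \<subseteq> Q" "Complete_Partial_Order.chain (\<le>) C" "a \<in> C"
    "\<And>w. w \<in> C \<Longrightarrow> a \<le> w \<and> w \<le> b" "card C = longest Q a b + 1"
    using longest_attained[OF Q] by metis
  have mono: "v t \<le> v s" if "s \<in> Q" "t \<in> Q" "s \<le> t" for s t
    using strict_antitone_onD[OF v, of s t] that by (cases "s = t") (auto simp: order_less_le)
  have "inj_on v C"
  proof (rule inj_onI, rule ccontr)
    fix s t assume "s \<in> C" "t \<in> C" "v s = v t" "s \<noteq> t"
    moreover from this have "s < t \<or> t < s"
      using C(2) unfolding chain_def by (metis order_less_le)
    ultimately show False
      using strict_antitone_onD[OF v] C(1) by (metis less_irrefl subsetD)
  qed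
  moreover have "v ` C \<subseteq> {v b..v a}"
    using C(1,4) Q mono by (auto intro!: mono)
  ultimately have "card C \<le> card {v b..v a}"
    by (intro card_inj_on_le) auto
  moreover have "v b \<le> v a"
    using Q mono by blast
  ultimately show ?thesis
    using C(5) by simp
qed

lemma longest_strict_antitone:
  fixes Q :: "'b::order set"
  assumes "finite Q" "a \<in> Q" "b \<in> Q" "c \<in> Q" "a < b" "b \<le> c"
  shows "longest Q b c < longest Q a c"
  using longest_superadditive[of Q a b c] longest_pos[of Q a b] assms by (simp add: less_imp_le)

lemma longest_cover:
  fixes Q :: "'b::order set"
  assumes Q: "finite Q" "covers_in Q x y"
  shows "longest Q y x = 1"
proof -
  have xy: "x \<in> Q" "y \<in> Q" "y < x" "\<And>z. z \<in> Q \<Longrightarrow> y < z \<Longrightarrow> \<not> z < x"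
    using Q(2) by (auto simp: covers_in_def)
  obtain C where C: "C \<subseteq> Q" "\<And>w. w \<in> C \<Longrightarrow> y \<le> w \<and> w \<le> x" "card C = longest Q y x + 1"
    using longest_attained[OF Q(1) xy(2,1) less_imp_le[OF xy(3)]] by metis
  have "C \<subseteq> {x, y}"
    using C(1,2) xy(4) by (auto simp: order_less_le)
  then have "card C \<le> 2"
    using card_mono[of "{x, y}" C] card_insert_le_m1[of 2 "{y}" x] by simp
  then show ?thesis
    using C(3) longest_pos[OF Q(1) xy(2,1,3)] by simp
qed

section \<open>Height, depth and rank in a finite poset with bounds\<close>

locale bounded_finite_poset =
  fixes Q :: "'b::order set" and bt tp :: 'b
  assumes finite_Q: "finite Q" and bt: "bt \<in> Q" "\<And>z. z \<in> Q \<Longrightarrow> bt \<le> z"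
    and tp: "tp \<in> Q" "\<And>z. z \<in> Q \<Longrightarrow> z \<le> tp"
begin

text \<open>Adjoining \<open>bt\<close> to a chain below \<open>z\<close> does not shorten it, so
  prescribing the lower endpoint costs nothing.\<close>

lemma height_eq_longest: "z \<in> Q \<Longrightarrow> height Q z = longest Q bt z"
proof (rule antisym)
  assume z: "z \<in> Q"
  have Z: "{z} \<subseteq> Q \<and> Complete_Partial_Order.chain (\<le>) {z} \<and> z \<in> {z} \<and> (\<forall>w\<in>{z}. w \<le> z)"
    using z by (simp add: chain_def)
  show "height Q z \<le> longest Q bt z"
    unfolding height_def
  proof (rule Max.boundedI)
    show "finite {chain_length C |C. C \<subseteq> Q \<and> Complete_Partial_Order.chain (\<le>) C \<and> z \<in> C \<and>
        (\<forall>w\<in>C. w \<le> z)}"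
      by (rule finite_chain_lengths[OF finite_Q])
    show "{chain_length C |C. C \<subseteq> Q \<and> Complete_Partial_Order.chain (\<le>) C \<and> z \<in> C \<and>
        (\<forall>w\<in>C. w \<le> z)} \<noteq> {}"
      using Z by blast
  next
    fix n assume "n \<in> {chain_length C |C. C \<subseteq> Q \<and> Complete_Partial_Order.chain (\<le>) C \<and> z \<in> C \<and>
        (\<forall>w\<in>C. w \<le> z)}"
    then obtain C where "n = chain_length C" "C \<subseteq> Q" "Complete_Partial_Order.chain (\<le>) C"
        "\<forall>w\<in>C. w \<le> z"
      by blast
    then show "n \<le> longest Q bt z"
      using card_chain_le_longest[OF finite_Q bt(1) z bt(2)[OF z], of C] bt(2)
      by (auto simp: chain_length_def subset_iff)
  qed
  obtain C where C: "C \<subseteq> Q" "Complete_Partial_Order.chain (\<le>) C" "z \<in> C"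
      "\<And>w. w \<in> C \<Longrightarrow> bt \<le> w \<and> w \<le> z" "card C = longest Q bt z + 1"
    using longest_attained[OF finite_Q bt(1) z bt(2)[OF z]] by metis
  have "chain_length C \<le> height Q z"
    unfolding height_def
    by (intro Max_ge finite_chain_lengths[OF finite_Q]) (use C in blast)
  with C(5) show "longest Q bt z \<le> height Q z"
    by (simp add: chain_length_def)
qed

lemma depth_eq_longest: "z \<in> Q \<Longrightarrow> depth Q z = longest Q z tp"
proof (rule antisym)
  assume z: "z \<in> Q"
  have Z: "{z} \<subseteq> Q \<and> Complete_Partial_Order.chain (\<le>) {z} \<and> z \<in> {z} \<and> (\<forall>w\<in>{z}. z \<le> w)"
    using z by (simp add: chain_def)
  show "depth Q z \<le> longest Q z tp"
    unfolding depth_def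
  proof (rule Max.boundedI)
    show "finite {chain_length C |C. C \<subseteq> Q \<and> Complete_Partial_Order.chain (\<le>) C \<and> z \<in> C \<and>
        (\<forall>w\<in>C. z \<le> w)}"
      by (rule finite_chain_lengths[OF finite_Q])
    show "{chain_length C |C. C \<subseteq> Q \<and> Complete_Partial_Order.chain (\<le>) C \<and> z \<in> C \<and>
        (\<forall>w\<in>C. z \<le> w)} \<noteq> {}"
      using Z by blast
  next
    fix n assume "n \<in> {chain_length C |C. C \<subseteq> Q \<and> Complete_Partial_Order.chain (\<le>) C \<and> z \<in> C \<and>
        (\<forall>w\<in>C. z \<le> w)}"
    then obtain C where "n = chain_length C" "C \<subseteq> Q" "Complete_Partial_Order.chain (\<le>) C"
        "\<forall>w\<in>C. z \<le> w"
      by blast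
    then show "n \<le> longest Q z tp"
      using card_chain_le_longest[OF finite_Q z tp(1) tp(2)[OF z], of C] tp(2)
      by (auto simp: chain_length_def subset_iff)
  qed
  obtain C where C: "C \<subseteq> Q" "Complete_Partial_Order.chain (\<le>) C" "z \<in> C"
      "\<And>w. w \<in> C \<Longrightarrow> z \<le> w \<and> w \<le> tp" "card C = longest Q z tp + 1"
    using longest_attained[OF finite_Q z tp(1) tp(2)[OF z]] by metis
  have "chain_length C \<le> depth Q z"
    unfolding depth_def
    by (intro Max_ge finite_chain_lengths[OF finite_Q]) (use C in blast)
  with C(5) show "longest Q z tp \<le> depth Q z"
    by (simp add: chain_length_def)
qed

lemma rank_eq_longest: "rank Q = longest Q bt tp"
proof (rule antisym)
  have Z: "{bt} \<subseteq> Q \<and> {bt} \<noteq> {} \<and> Complete_Partial_Order.chain (\<le>) {bt}"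
    using bt by (simp add: chain_def)
  show "rank Q \<le> longest Q bt tp"
    unfolding rank_def
  proof (rule Max.boundedI)
    show "finite {chain_length C |C. C \<subseteq> Q \<and> C \<noteq> {} \<and> Complete_Partial_Order.chain (\<le>) C}"
      by (rule finite_chain_lengths[OF finite_Q])
    show "{chain_length C |C. C \<subseteq> Q \<and> C \<noteq> {} \<and> Complete_Partial_Order.chain (\<le>) C} \<noteq> {}"
      using Z by blast
  next
    fix n assume "n \<in> {chain_length C |C. C \<subseteq> Q \<and> C \<noteq> {} \<and> Complete_Partial_Order.chain (\<le>) C}"
    then obtain C where C: "n = chain_length C" "C \<subseteq> Q" "Complete_Partial_Order.chain (\<le>) C"
      by blast
    moreover have "bt \<le> w \<and> w \<le> tp" if "w \<in> C" for w
      using that C bt tp by blast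
    ultimately show "n \<le> longest Q bt tp"
      using card_chain_le_longest[OF finite_Q bt(1) tp(1) tp(2)[OF bt(1)], of C]
      by (auto simp: chain_length_def)
  qed
  obtain C where C: "C \<subseteq> Q" "Complete_Partial_Order.chain (\<le>) C" "bt \<in> C"
      "card C = longest Q bt tp + 1"
    using longest_attained[OF finite_Q bt(1) tp(1) tp(2)[OF bt(1)]] by metis
  have "chain_length C \<le> rank Q"
    unfolding rank_def
    by (intro Max_ge finite_chain_lengths[OF finite_Q]) (use C in blast)
  with C(4) show "longest Q bt tp \<le> rank Q"
    by (simp add: chain_length_def)
qed

text \<open>Together with \<open>depth_tp\<close> and \<open>depth_bt\<close> this makes
  \<open>depth\<close> a map of degree \<open>rank Q\<close>, the least degree possible by
  \<open>rank_le_strict_antitone_on\<close>.\<close>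

lemma strict_antitone_on_depth: "strict_antitone_on Q (depth Q)"
  unfolding strict_antitone_on_def
  by (auto simp: depth_eq_longest intro: longest_strict_antitone finite_Q tp)

lemma depth_tp: "depth Q tp = 0"
  by (simp add: depth_eq_longest tp finite_Q)

lemma depth_bt: "depth Q bt = rank Q"
  by (simp add: depth_eq_longest rank_eq_longest bt)

lemma rank_le_strict_antitone_on: "strict_antitone_on Q v \<Longrightarrow> rank Q \<le> v bt"
  using strict_antitone_on_longest[OF _ finite_Q bt(1) tp(1) tp(2)[OF bt(1)], of v]
  by (simp add: rank_eq_longest)

lemma height_add_depth_le: "z \<in> Q \<Longrightarrow> height Q z + depth Q z \<le> rank Q"
  using longest_superadditive[OF finite_Q bt(1) _ tp(1), of z] bt(2) tp(2)
  by (simp add: height_eq_longest depth_eq_longest rank_eq_longest)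

text \<open>The least strictly order-reversing map that is 0 at \<open>tp\<close> and at least \<open>depth Q y - 1\<close>
  at \<open>x\<close>.\<close>

definition lifted_depth :: "'b \<Rightarrow> 'b \<Rightarrow> 'b \<Rightarrow> nat" where
  "lifted_depth x y z =
     max (depth Q z) (if z \<le> x then depth Q y - 1 + longest Q z x else 0)"

text \<open>Below \<open>x\<close> both terms of the maximum drop strictly. If the upper element of
  a step is not below \<open>x\<close>, its value is just its depth.\<close>

lemma strict_antitone_on_lifted_depth:
  assumes "x \<in> Q"
  shows "strict_antitone_on Q (lifted_depth x y)"
  unfolding strict_antitone_on_def
proof (intro ballI impI)
  fix s t assume st: "s \<in> Q" "t \<in> Q" "t < s"
  have "depth Q s < depth Q t"
    using strict_antitone_onD[OF strict_antitone_on_depth st(3)] st by simp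
  moreover have "t \<le> x \<and> longest Q s x < longest Q t x" if "s \<le> x"
    using longest_strict_antitone[OF finite_Q, of t s x] st that assms by auto
  ultimately show "lifted_depth x y s < lifted_depth x y t"
    by (auto simp: lifted_depth_def)
qed

lemma lifted_depth_tp: "x \<in> Q \<Longrightarrow> x \<noteq> tp \<Longrightarrow> lifted_depth x y tp = 0"
  using tp(2)[of x] by (auto simp: lifted_depth_def depth_tp)

text \<open>From \<open>y\<close> to \<open>x\<close> the map \<open>lifted_depth x y\<close> drops by at most 1, hence so does \<open>v\<close>, while
  \<open>v y \<ge> depth Q y\<close> and \<open>v x \<le> rank Q - height Q x\<close>.\<close>

lemma lifted_depth_obstruction:
  assumes xy: "covers_in Q x y" "x \<noteq> tp"
    and v: "strict_antitone_on Q v" "v bt = rank Q"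
      "v y + lifted_depth x y x \<le> v x + lifted_depth x y y"
  shows "height Q x + depth Q y \<le> rank Q + 1"
proof -
  have Q: "x \<in> Q" "y \<in> Q" "y < x"
    using xy by (auto simp: covers_in_def)
  \<comment> \<open>Makes the truncated \<open>depth Q y - 1 + 1\<close> equal to
    \<open>depth Q y\<close>.\<close>
  have "1 \<le> depth Q y"
    using longest_pos[OF finite_Q Q(2) tp(1)] Q tp(2)[OF Q(1)] by (auto simp: depth_eq_longest)
  then have "lifted_depth x y y = depth Q y"
    using Q longest_cover[OF finite_Q xy(1)] by (simp add: lifted_depth_def)
  moreover have "depth Q y - 1 \<le> lifted_depth x y x"
    by (simp add: lifted_depth_def)
  moreover have "v x + height Q x \<le> rank Q"
    using strict_antitone_on_longest[OF v(1) finite_Q bt(1) Q(1) bt(2)[OF Q(1)]] v(2)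
    by (simp add: height_eq_longest Q)
  moreover have "depth Q y \<le> v y"
    using strict_antitone_on_longest[OF v(1) finite_Q Q(2) tp(1) tp(2)[OF Q(2)]]
    by (simp add: depth_eq_longest Q)
  ultimately show ?thesis
    using v(3) by linarith
qed

end

section \<open>Two chains joined by a single covering relation\<close>

text \<open>\<open>cross\<close> is the form in which the single diagonal is used: every
  comparability between the two chains passes through \<open>y < x\<close>, with \<open>A\<close> on
  the upper side. In particular \<open>A\<close> and \<open>B\<close> are disjoint.\<close>

locale single_diagonal = bounded_finite_poset Q bt tp
  for Q :: "'b::order set" and bt tp +
  fixes A B :: "'b set" and x y :: 'b
  assumes Q_eq: "Q = {bt, tp} \<union> A \<union> B" and inner: "bt \<notin> A \<union> B" "tp \<notin> A \<union> B"
    and chains: "Complete_Partial_Order.chain (\<le>) A" "Complete_Partial_Order.chain (\<le>) B"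
    and xy: "x \<in> A" "y \<in> B" "y < x"
    and cross: "\<And>u w. u \<in> A \<Longrightarrow> w \<in> B \<Longrightarrow> u \<le> w \<or> w \<le> u \<Longrightarrow> w \<le> y \<and> x \<le> u"
begin

lemma xy_Q: "x \<in> Q" "y \<in> Q"
  using xy Q_eq by auto

lemma covers_xy: "covers_in Q x y"
proof -
  have "\<not> (y < z \<and> z < x)" if "z \<in> Q" for z
    using that cross[of x z] cross[of z y] xy xy_Q bt(2)[of y] tp(2)[of x] unfolding Q_eq by force
  then show ?thesis
    using xy xy_Q by (auto simp: covers_in_def)
qed

text \<open>A longest chain that avoids \<open>A\<close> is comparable with \<open>y\<close>
  throughout. One that meets \<open>A\<close> has all its \<open>B\<close>-elements below
  \<open>y\<close>, hence below \<open>x\<close>, so it is comparable with \<open>x\<close>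
  throughout.\<close>

lemma rank_le: "rank Q \<le> max (height Q x + depth Q x) (height Q y + depth Q y)"
proof -
  obtain C where C: "C \<subseteq> Q" "Complete_Partial_Order.chain (\<le>) C"
      "card C = rank Q + 1"
    using longest_attained[OF finite_Q bt(1) tp(1) tp(2)[OF bt(1)]] by (metis rank_eq_longest)
  have through: "rank Q \<le> height Q z + depth Q z"
    if "z \<in> Q" "\<And>w. w \<in> C \<Longrightarrow> w \<le> z \<or> z \<le> w" for z
    using card_chain_le_longest_add[OF finite_Q bt(1) that(1) tp(1) _ _ C(1,2) _ that(2)]
      C(1,3) bt(2) tp(2) that(1)
    by (auto simp: height_eq_longest depth_eq_longest)
  show ?thesis
  proof (cases "C \<inter> A = {}")
    case True
    then have "w \<le> y \<or> y \<le> w" if "w \<in> C" for w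
      using that C(1) bt(2) tp(2) xy_Q chains(2) xy(2) unfolding Q_eq chain_def by blast
    from through[OF xy_Q(2) this] show ?thesis by simp
  next
    case False
    then obtain u where u: "u \<in> C" "u \<in> A" by blast
    have "w \<le> x \<or> x \<le> w" if w: "w \<in> C" for w
    proof (cases "w \<in> B")
      case True
      then have "w \<le> y"
        using cross[OF u(2), of w] C(2) u w unfolding chain_def by blast
      with xy(3) show ?thesis by (meson less_imp_le order_trans)
    next
      case False
      then show ?thesis
        using w C(1) bt(2) tp(2) xy_Q chains(1) xy(1) unfolding Q_eq chain_def by blast
    qed
    from through[OF xy_Q(1) this] show ?thesis by simp
  qed
qed

text \<open>By \<open>rank_le\<close> the rank is attained at \<open>x\<close> or at
  \<open>y\<close>. If it is \<open>height Q x + depth Q x\<close>, the left side says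
  \<open>depth Q y \<le> depth Q x + 1\<close>, and equality follows because depth drops strictly
  from \<open>y\<close> to \<open>x\<close>. The other case is dual, and the converse is
  \<open>height_add_depth_le\<close>.\<close>

lemma height_add_depth_iff:
  "height Q x + depth Q y \<le> rank Q + 1 \<longleftrightarrow>
     depth Q y = depth Q x + 1 \<or> height Q x = height Q y + 1"
proof -
  have "depth Q x < depth Q y"
    using strict_antitone_onD[OF strict_antitone_on_depth xy(3)] xy_Q by simp
  moreover have "height Q y < height Q x"
    using longest_superadditive[OF finite_Q bt(1) xy_Q(2,1) bt(2)] longest_pos[OF finite_Q xy_Q(2,1)]
      xy(3) xy_Q by (simp add: height_eq_longest less_imp_le)
  ultimately show ?thesis
    using height_add_depth_le[OF xy_Q(1)] height_add_depth_le[OF xy_Q(2)] rank_le by linarith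
qed

text \<open>The set \<open>I\<close> below is the smallest down-set that contains \<open>bt\<close> and is closed under going up
  along steps where \<open>v\<close> drops by exactly 1.\<close>

lemma ex_slack_down_set:
  assumes v: "strict_antitone_on Q v" "v tp = 0" and N: "rank Q < v bt"
    and b: "height Q x + depth Q y \<le> rank Q + 1"
  obtains I where "I \<subseteq> Q" "bt \<in> I" "tp \<notin> I"
    "\<And>z w. z \<in> I \<Longrightarrow> w \<in> Q \<Longrightarrow> w < z \<Longrightarrow> w \<in> I"
    "\<And>z w. z \<in> I \<Longrightarrow> w \<in> Q \<Longrightarrow> w \<notin> I \<Longrightarrow> z < w \<Longrightarrow> v w + 2 \<le> v z"
proof -
  \<comment> \<open>\<open>T z\<close> is tightness from the bottom: \<open>v\<close> drops from
    \<open>bt\<close> to \<open>z\<close> as little as \<open>strict_antitone_on_longest\<close>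
    permits.\<close>
  define T where "T z \<longleftrightarrow> v z + longest Q bt z = v bt" for z
  \<comment> \<open>The closure in explicit form: first the elements that are tight from the bottom.
    If \<open>x\<close> is among them, its whole down-set follows, including \<open>y\<close>, and
    then the elements of \<open>B\<close> that are tight relative to \<open>y\<close>.\<close>
  define I where "I = {z \<in> Q. T z} \<union>
    (if T x then {z \<in> Q. z \<le> x} \<union> {z \<in> B. y \<le> z \<and> v z + longest Q y z = v y} else {})"
  have bound: "v c + longest Q a c \<le> v a" if "a \<in> Q" "c \<in> Q" "a \<le> c" for a c
    using strict_antitone_on_longest[OF v(1) finite_Q that] .
  have less: "v c < v a" if "a \<in> Q" "c \<in> Q" "a < c" for a c
    using strict_antitone_onD[OF v(1) that(3,2,1)] .
  \<comment> \<open>A tight interval can be cut at any \<open>w\<close> comparable with all its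
    elements.\<close>
  have down: "v w + longest Q a w = v a"
    if "a \<in> Q" "w \<in> Q" "z \<in> Q" "a \<le> w" "w \<le> z" "v z + longest Q a z = v a"
      "\<And>u. u \<in> Q \<Longrightarrow> a \<le> u \<Longrightarrow> u \<le> z \<Longrightarrow> u \<le> w \<or> w \<le> u" for a w z
    using longest_split_le[OF finite_Q that(1,2,3,4,5,7)] bound[OF that(1,2,4)]
      bound[OF that(2,3,5)] that(6) by linarith
  \<comment> \<open>The longest chain grows by at least 1 and \<open>v\<close> drops by at most 1,
    so tightness persists.\<close>
  have up: "v w + longest Q a w = v a"
    if "a \<in> Q" "z \<in> Q" "w \<in> Q" "a \<le> z" "z < w" "v z + longest Q a z = v a" "v z \<le> v w + 1" for a w z
    using longest_superadditive[OF finite_Q that(1,2,3,4) less_imp_le[OF that(5)]]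
      longest_pos[OF finite_Q that(2,3,5)] bound[of a w] that by fastforce
  have A: "u \<le> w \<or> w \<le> u" if "u \<in> A" "w \<in> A" for u w
    using chains(1) that unfolding chain_def by blast
  have B: "u \<le> w \<or> w \<le> u" if "u \<in> B" "w \<in> B" for u w
    using chains(2) that unfolding chain_def by blast
  have AB: "A \<subseteq> Q" "B \<subseteq> Q"
    using Q_eq by auto
  have disj: "u \<notin> B" if "u \<in> A" for u
    using cross[of u u] that xy(3) by auto
  have T_tp: "\<not> T tp"
    using v(2) N by (simp add: T_def rank_eq_longest)
  have T_bt: "T bt"
    by (simp add: T_def finite_Q bt)
  have below: "u = bt \<or> u \<in> A \<and> z \<in> A \<or> u \<in> B \<and> z \<in> B \<or> u \<in> B \<and> z \<in> A \<and> u \<le> y \<and> x \<le> z"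
    if "u \<in> Q" "u \<le> z" "z \<in> A \<or> z \<in> B" for u z
  proof -
    have "u \<noteq> tp"
      using that inner AB tp(2)[of z] by (auto dest: antisym)
    then show ?thesis
      using that cross[of z u] cross[of u z] xy(3) unfolding Q_eq by force
  qed
  have I_tp: "tp \<notin> I"
    using T_tp inner tp xy_Q(1) xy(1) by (auto simp: I_def dest: antisym)
  show thesis
  proof (rule that[of I])
    show "I \<subseteq> Q"
      using AB by (auto simp: I_def)
    show "bt \<in> I"
      using T_bt bt by (simp add: I_def)
    show "tp \<notin> I"
      by (rule I_tp)
  next
    fix z w assume z: "z \<in> I" and w: "w \<in> Q" "w < z"
    have zQ: "z \<in> Q" and z_tp: "z \<noteq> tp"
      using z I_tp AB by (auto simp: I_def split: if_splits)
    have zAB: "z \<in> A \<or> z \<in> B"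
      using zQ z_tp bt(2)[OF w(1)] w(2) unfolding Q_eq by auto
    \<comment> \<open>The excluded case is \<open>z\<close> in \<open>A\<close> above
      \<open>x\<close> with \<open>w\<close> not above \<open>x\<close>: there an
      \<open>A\<close>-element below \<open>x\<close> and a \<open>B\<close>-element below
      \<open>y\<close> can be incomparable.\<close>
    have comp: "u \<le> w \<or> w \<le> u" if "u \<in> Q" "u \<le> z" "z \<in> B \<or> \<not> x \<le> z \<or> x \<le> w" for u
    proof -
      have "u = bt \<or> w = bt \<or> u \<in> A \<and> w \<in> A \<or> u \<in> B \<and> w \<in> B \<or>
          w \<in> B \<and> z \<in> A \<and> w \<le> y \<and> x \<le> z \<or> u \<in> B \<and> z \<in> A \<and> u \<le> y \<and> x \<le> z"
        using below[OF w(1) less_imp_le[OF w(2)] zAB] below[OF that(1,2) zAB] disj by blast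
      moreover have "w \<le> y \<Longrightarrow> \<not> x \<le> w" "u \<le> y \<Longrightarrow> x \<le> w \<Longrightarrow> u \<le> w"
        using xy(3) by auto
      ultimately show ?thesis
        using that A[of u w] B[of u w] bt(2)[OF w(1)] bt(2)[OF that(1)] disj by blast
    qed
    have T_down: "T w" if "T z" "z \<in> B \<or> \<not> x \<le> z \<or> x \<le> w"
      using down[of bt w z] comp[OF _ _ that(2)] bt w zQ that(1) by (auto simp: T_def)
    \<comment> \<open>Every \<open>B\<close>-element below \<open>z\<close> lies below
      \<open>y\<close>, so \<open>x\<close> is comparable with everything below
      \<open>z\<close>.\<close>
    have T_x: "T x" if "T z" "x \<le> z" "z \<in> A"
    proof -
      have "u \<le> x \<or> x \<le> u" if "u \<in> Q" "u \<le> z" for u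
        using below[OF that zAB] A[OF _ xy(1), of u] bt(2)[OF xy_Q(1)] xy(3) disj \<open>z \<in> A\<close> by auto
      then show ?thesis
        using down[of bt x z] bt xy_Q zQ that by (auto simp: T_def)
    qed
    show "w \<in> I"
    proof (cases "T x \<and> w \<le> x \<or> T w")
      case True
      then show ?thesis using w by (auto simp: I_def)
    next
      case False
      then have nT: "\<not> T w" "\<not> (T x \<and> w \<le> x)" by auto
      \<comment> \<open>If \<open>z\<close> were tight and \<open>w\<close> not, \<open>z\<close>
        would lie in \<open>A\<close> above \<open>x\<close>, so \<open>x\<close> would be tight.
        Then \<open>w\<close>, not being above \<open>x\<close>, would lie below it, which
        \<open>nT\<close> excludes.\<close>
      have "\<not> T z"
      proof
        assume Tz: "T z"
        then have "x \<le> z" "z \<notin> B" "\<not> x \<le> w"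
          using T_down nT(1) by auto
        with T_x[OF Tz] zAB nT(2) have "\<not> w \<le> x"
          by blast
        then show False
          using below[OF w(1) less_imp_le[OF w(2)] zAB] \<open>z \<notin> B\<close> \<open>\<not> x \<le> w\<close> A[OF _ xy(1), of w]
            bt(2)[OF xy_Q(1)] xy(3) by auto
      qed
      moreover have "\<not> (T x \<and> z \<le> x)"
        using nT(2) w(2) by auto
      ultimately have Tx: "T x" and zB: "z \<in> B" "y \<le> z" "v z + longest Q y z = v y"
        using z by (auto simp: I_def split: if_splits)
      then have wB: "w \<in> B"
        using below[OF w(1) less_imp_le[OF w(2)] zAB] nT(2) bt(2)[OF xy_Q(1)] disj by auto
      then have "y \<le> w"
        using B[OF _ xy(2), of w] nT(2) Tx xy(3) by auto
      then have "v w + longest Q y w = v y"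
        using down[of y w z] comp zB xy_Q w zQ by auto
      then show ?thesis
        using Tx wB \<open>y \<le> w\<close> by (auto simp: I_def)
    qed
  next
    fix z w assume z: "z \<in> I" and w: "w \<in> Q" "w \<notin> I" "z < w"
    have zQ: "z \<in> Q"
      using z AB by (auto simp: I_def split: if_splits)
    show "v w + 2 \<le> v z"
    proof (rule ccontr)
      assume "\<not> ?thesis"
      then have step: "v z \<le> v w + 1" by simp
      have nT: "\<not> T w"
        using w by (auto simp: I_def)
      then have nTz: "\<not> T z"
        using up[of bt z w] bt zQ w step by (auto simp: T_def)
      then have Tx: "T x" and nwx: "\<not> w \<le> x" and z': "z \<le> x \<or> z \<in> B \<and> y \<le> z \<and> v z + longest Q y z = v y"
        using z w by (auto simp: I_def split: if_splits)
      have zx: "z \<noteq> x" using Tx nTz by auto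
      \<comment> \<open>The strict drops from \<open>z\<close> to \<open>x\<close> and from
        \<open>x\<close> to \<open>w\<close> would add up to at least 2.\<close>
      have not_between: "\<not> x < w" if "z \<le> x"
        using less[OF zQ xy_Q(1)] less[OF xy_Q(1) w(1)] that zx step by fastforce
      have z_bt: "z \<noteq> bt" using T_bt nTz by auto
      \<comment> \<open>If \<open>z \<le> x\<close>, the step from \<open>z\<close> to
        \<open>w\<close> ends in \<open>B\<close> above \<open>y\<close>. Starting strictly below
        \<open>y\<close> would again cost 2, so \<open>z = y\<close>, where the condition is
        trivial.\<close>
      have zy: "z \<in> B \<and> y \<le> z \<and> v z + longest Q y z = v y" if "w \<in> B"
      proof (cases "z \<le> x")
        case True
        have "\<not> w \<le> y" using nwx xy(3) by auto
        then have yw: "y < w" and "z \<notin> A"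
          using B[OF that xy(2)] cross[of z w] that less_imp_le[OF w(3)] by auto
        moreover have "z \<noteq> tp" using tp(2)[OF w(1)] w(3) by auto
        ultimately have "z \<in> B" using zQ z_bt unfolding Q_eq by auto
        then have "z \<le> y"
          using cross[OF xy(1), of z] True by auto
        moreover have "\<not> z < y"
          using less[OF zQ xy_Q(2)] less[OF xy_Q(2) w(1)] yw step by fastforce
        ultimately have "z = y" by simp
        then show ?thesis using xy xy_Q finite_Q by simp
      next
        case False
        then show ?thesis using z' by auto
      qed
      consider "w = tp" | "w \<in> A" | "w \<in> B"
        using w(1,3) bt(2)[OF zQ] unfolding Q_eq by auto
      then show False
      proof cases
        case 1
        then have "\<not> z \<le> x"
          using not_between tp(2)[OF xy_Q(1)] inner xy(1) by auto
        then have "v tp + longest Q y tp = v y"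
          using up[of y z tp] z' xy_Q zQ w step 1 by auto
        \<comment> \<open>Here \<open>b\<close> enters. Tightness from \<open>y\<close> to the top
          gives \<open>v y = depth Q y\<close>; with \<open>T x\<close> and \<open>v x < v y\<close>
          this yields \<open>v bt \<le> height Q x + depth Q y - 1 \<le> rank Q\<close>.\<close>
        then show False
          using v(2) b less[OF xy_Q(2,1) xy(3)] Tx N
          by (simp add: T_def height_eq_longest depth_eq_longest xy_Q)
      next
        case 2
        then have "x < w"
          using A[OF 2 xy(1)] nwx by auto
        with not_between have "\<not> z \<le> x" by blast
        then have "z \<in> B" "y \<le> z" using z' by auto
        \<comment> \<open>\<open>cross\<close> puts \<open>z\<close> below \<open>y\<close> as well;
          but \<open>y\<close> is below \<open>x\<close> and \<open>z\<close> is not.\<close>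
        then have "z = y"
          using cross[OF 2, of z] less_imp_le[OF w(3)] by auto
        with xy(3) \<open>\<not> z \<le> x\<close> show False by simp
      next
        case 3
        then have "v w + longest Q y w = v y" "y \<le> w"
          using zy up[of y z w] xy_Q zQ w step by auto
        then show False
          using 3 Tx w(2) by (auto simp: I_def)
      qed
    qed
  qed
qed

end

section \<open>The ring-theoretic meaning of levelness\<close>

lemma join_irreducible_le_Sup_fin:
  fixes x :: "'a::{finite, distrib_lattice}"
  assumes "x \<in> join_irreducibles" "finite F" "F \<noteq> {}" "x \<le> Sup_fin F"
  shows "\<exists>z\<in>F. x \<le> z"
  using assms(2,3,4)
proof (induction F rule: finite_ne_induct)
  case (insert a F)
  then show ?case
    using join_irreducible_le_sup[OF assms(1), of a "Sup_fin F"] by auto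
qed simp

text \<open>The surjectivity half of Birkhoff's correspondence: take the join of the ideal. The
  bottom is added so that \<open>Sup_fin\<close> has a nonempty argument even for
  \<open>I = {}\<close>; no join-irreducible element lies below it.\<close>

lemma ex_down_set_of_join_irreducibles:
  fixes I :: "'a::{finite, distrib_lattice} set"
  assumes "I \<subseteq> join_irreducibles"
    and down: "\<And>u z. z \<in> I \<Longrightarrow> u \<in> join_irreducibles \<Longrightarrow> u \<le> z \<Longrightarrow> u \<in> I"
  shows "\<exists>\<alpha>. {u \<in> join_irreducibles. u \<le> \<alpha>} = I"
proof
  let ?F = "insert (Inf_fin UNIV) I"
  show "{u \<in> join_irreducibles. u \<le> Sup_fin ?F} = I"
  proof (intro equalityI subsetI)
    fix u assume "u \<in> {u \<in> join_irreducibles. u \<le> Sup_fin ?F}"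
    then have u: "u \<in> join_irreducibles" "u \<le> Sup_fin ?F" by auto
    then obtain z where "z \<in> ?F" "u \<le> z"
      using join_irreducible_le_Sup_fin[OF u(1) _ _ u(2)] by auto
    moreover have "\<not> u \<le> Inf_fin UNIV"
      using u(1) Inf_fin.coboundedI[of UNIV u] by (auto simp: join_irreducibles_def)
    ultimately show "u \<in> I"
      using down u(1) by blast
  next
    fix u assume "u \<in> I"
    then show "u \<in> {u \<in> join_irreducibles. u \<le> Sup_fin ?F}"
      using assms(1) by (auto intro: Sup_fin.coboundedI)
  qed
qed

lemma hibi_monomial_eq_single:
  fixes \<alpha> :: "'a::{finite, distrib_lattice}"
  obtains u where "(hibi_monomial \<alpha> :: ('a extended, 'k::field) polys) = Poly_Mapping.single u 1"
    "Poly_Mapping.lookup u Minf = 1" "Poly_Mapping.lookup u Pinf = 0"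
    "\<And>z. Poly_Mapping.lookup u (Fin z) = (if z \<in> join_irreducibles \<and> z \<le> \<alpha> then 1 else 0)"
proof
  let ?I = "{x \<in> join_irreducibles. x \<le> \<alpha>}"
  let ?u = "Poly_Mapping.single Minf 1 + (\<Sum>x\<in>?I. Poly_Mapping.single (Fin x) 1)
    :: 'a extended \<Rightarrow>\<^sub>0 nat"
  show "(hibi_monomial \<alpha> :: ('a extended, 'k) polys) = Poly_Mapping.single ?u 1"
    unfolding hibi_monomial_def prod_Var[OF finite, of Fin]
    by (simp add: Var_def mult_single)
  show "Poly_Mapping.lookup ?u Minf = 1" "Poly_Mapping.lookup ?u Pinf = 0"
    "\<And>z. Poly_Mapping.lookup ?u (Fin z) = (if z \<in> join_irreducibles \<and> z \<le> \<alpha> then 1 else 0)"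
    by (simp_all add: lookup_add lookup_sum lookup_single when_def)
qed

text \<open>With \<open>keys_hibi_embed\<close> this identifies the monomials in the image of
  \<open>K[L]\<close>. Induction on the degree: the support of \<open>w\<close> among the
  join-irreducible elements is a poset ideal, the generator of that ideal divides the monomial, and
  the quotient exponent is again order-reversing.\<close>

lemma hibi_embed_onto_S_monomials:
  fixes w :: "'a::{finite, distrib_lattice} extended \<Rightarrow>\<^sub>0 nat"
  assumes "w \<in> S_maps join_irreducibles"
  shows "\<exists>r :: ('a, 'k::field) hibi_ring. hibi_embed r = Poly_Mapping.single w 1"
  using assms
proof (induction "Poly_Mapping.lookup w Minf" arbitrary: w)
  case 0
  have "Poly_Mapping.lookup w z = 0" for z
  proof (cases "z \<in> hat join_irreducibles")
    case True
    moreover have "Minf \<in> hat join_irreducibles" by (simp add: hat_def)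
    ultimately have "Poly_Mapping.lookup w z \<le> Poly_Mapping.lookup w Minf"
      using "0.prems" Minf_le unfolding S_maps_def by blast
    with "0.hyps" show ?thesis by simp
  qed (use "0.prems" in \<open>auto simp: S_maps_def in_keys_iff\<close>)
  then have "w = 0" by (intro poly_mapping_eqI) simp
  then show ?case
    by (intro exI[of _ 1]) (simp add: hibi_embed_one)
next
  case (Suc n)
  let ?l = Poly_Mapping.lookup
  have w: "Poly_Mapping.keys w \<subseteq> hat join_irreducibles" "?l w Pinf = 0"
    "\<And>s t. s \<in> hat join_irreducibles \<Longrightarrow> t \<in> hat join_irreducibles \<Longrightarrow> s \<le> t \<Longrightarrow> ?l w t \<le> ?l w s"
    using Suc.prems by (auto simp: S_maps_def)
  define I where "I = {z \<in> join_irreducibles. 1 \<le> ?l w (Fin z)}"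
  have down: "u \<in> I" if "z \<in> I" "u \<in> join_irreducibles" "u \<le> z" for u z
    using that w(3)[of "Fin u" "Fin z"] by (auto simp: I_def hat_def)
  obtain \<alpha> where \<alpha>: "{u \<in> join_irreducibles. u \<le> \<alpha>} = I"
    using ex_down_set_of_join_irreducibles[of I] down unfolding I_def by blast
  obtain u where u: "(hibi_monomial \<alpha> :: ('a extended, 'k) polys) = Poly_Mapping.single u 1"
      "?l u Minf = 1" "?l u Pinf = 0"
      "\<And>z. ?l u (Fin z) = (if z \<in> join_irreducibles \<and> z \<le> \<alpha> then 1 else 0)"
    using hibi_monomial_eq_single by blast
  then have uI: "?l u (Fin z) = (if z \<in> I then 1 else 0)" for z
    using \<alpha> by auto
  have le: "?l u z \<le> ?l w z" for z
    using Suc.hyps(2) u(2,3) by (cases z) (auto simp: uI I_def)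
  then have eq: "w = u + (w - u)"
    by (intro poly_mapping_eqI) (simp add: lookup_add lookup_minus)
  have mono: "?l w t - ?l u t \<le> ?l w s - ?l u s"
    if st: "s \<in> hat join_irreducibles" "t \<in> hat join_irreducibles" "s \<le> t" for s t
  proof (cases t)
    case (Fin b)
    have ws: "?l w t \<le> ?l w s" by (rule w(3)[OF st])
    have "b \<in> join_irreducibles" using st(2) Fin by (auto simp: hat_def)
    \<comment> \<open>True also outside \<open>I\<close>, where \<open>?l w t = 0\<close> and
      subtraction is truncated.\<close>
    then have "?l w t - ?l u t = ?l w t - 1"
      by (simp add: Fin uI I_def)
    moreover have "?l u s \<le> 1"
      using u(2,3) by (cases s) (auto simp: uI)
    ultimately show ?thesis using ws by linarith
  qed (use st w(2) in auto)
  have "w - u \<in> S_maps join_irreducibles"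
    unfolding S_maps_def
  proof (intro CollectI conjI ballI impI)
    show "Poly_Mapping.keys (w - u) \<subseteq> hat join_irreducibles"
      using w(1) by (auto simp: in_keys_iff lookup_minus)
    show "?l (w - u) Pinf = 0" by (simp add: lookup_minus w(2))
    fix s t :: "'a extended"
    assume "s \<in> hat join_irreducibles" "t \<in> hat join_irreducibles" "t \<le> s"
    then show "?l (w - u) s \<le> ?l (w - u) t"
      using mono by (simp add: lookup_minus)
  qed
  moreover have "n = ?l (w - u) Minf"
    using Suc.hyps(2) u(2) by (simp add: lookup_minus)
  ultimately obtain r :: "('a, 'k) hibi_ring" where "hibi_embed r = Poly_Mapping.single (w - u) 1"
    using Suc.hyps(1) by blast
  moreover have "hibi_embed (abs_hibi_ring (Var \<alpha>) :: ('a, 'k) hibi_ring) = Poly_Mapping.single u 1"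
    by (simp add: hibi_embed.abs_eq hibi_subst_Var u(1))
  ultimately have "hibi_embed (abs_hibi_ring (Var \<alpha>) * r) = Poly_Mapping.single w 1"
    using eq by (simp add: hibi_embed_mult mult_single)
  then show ?case by blast
qed

text \<open>The module is spanned by monomials and the ring acts through monomials, so generation
  can be tested on exponent vectors. The condition reads \<open>v = w + v'\<close> because
  subtraction of naturals would be truncated.\<close>

lemma span_canonical_module_degree_iff:
  "module.span (hibi_scale :: ('a::{finite, distrib_lattice}, 'k::field) hibi_ring \<Rightarrow> _)
      (canonical_module_degree d) = canonical_module \<longleftrightarrow>
   (\<forall>v\<in>T_maps (join_irreducibles :: 'a set).
      \<exists>v'\<in>T_maps join_irreducibles. Poly_Mapping.lookup v' Minf = d \<and>
        (\<exists>w\<in>S_maps join_irreducibles. v = w + v'))"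
  (is "?span = _ \<longleftrightarrow> (\<forall>v\<in>_. ?gen v)")
proof
  assume span: "?span = canonical_module"
  \<comment> \<open>The polynomials all of whose exponents are reachable from degree
    \<open>d\<close> form a submodule containing the generators, hence containing the span.\<close>
  let ?G = "{p :: ('a extended, 'k) polys. \<forall>v\<in>Poly_Mapping.keys p. ?gen v}"
  have sub: "module.subspace (hibi_scale :: ('a, 'k) hibi_ring \<Rightarrow> _) ?G"
  proof (rule module.subspaceI[OF module_hibi_scale])
    fix p q :: "('a extended, 'k) polys"
    assume "p \<in> ?G" "q \<in> ?G"
    then show "p + q \<in> ?G"
      using Poly_Mapping.keys_add[of p q] by blast
  next
    fix r :: "('a, 'k) hibi_ring" and p :: "('a extended, 'k) polys"
    assume p: "p \<in> ?G"
    have "?gen v" if v: "v \<in> Poly_Mapping.keys (hibi_scale r p)" for v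
    proof -
      obtain a b where ab: "a \<in> Poly_Mapping.keys (hibi_embed r)" "b \<in> Poly_Mapping.keys p" "v = a + b"
        using v Poly_Mapping.keys_mult[of "hibi_embed r" p] by (auto simp: hibi_scale_def)
      then have "a \<in> S_maps join_irreducibles"
        using keys_hibi_embed by blast
      moreover obtain v' w where v': "v' \<in> T_maps join_irreducibles" "Poly_Mapping.lookup v' Minf = d"
          "w \<in> S_maps join_irreducibles" "b = w + v'"
        using p ab(2) by blast
      ultimately have "a + w \<in> S_maps join_irreducibles" "v = (a + w) + v'"
        using ab(3) by (auto simp: S_maps_add add.assoc)
      with v' show ?thesis by blast
    qed
    then show "hibi_scale r p \<in> ?G" by blast
  qed simp
  have "canonical_module_degree d \<subseteq> ?G"
  proof
    fix p :: "('a extended, 'k) polys"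
    assume p: "p \<in> canonical_module_degree d"
    have "?gen v" if "v \<in> Poly_Mapping.keys p" for v
      using p that S_maps_zero[of join_irreducibles]
      by (intro bexI[of _ v] conjI bexI[of _ 0])
        (auto simp: canonical_module_degree_def canonical_module_def)
    then show "p \<in> ?G" by blast
  qed
  then have G: "canonical_module \<subseteq> ?G"
    using module.span_minimal[OF module_hibi_scale _ sub] span by blast
  show "\<forall>v\<in>T_maps join_irreducibles. ?gen v"
  proof
    fix v :: "'a extended \<Rightarrow>\<^sub>0 nat"
    assume "v \<in> T_maps join_irreducibles"
    then have "(Poly_Mapping.single v 1 :: ('a extended, 'k) polys) \<in> canonical_module"
      by (simp add: canonical_module_def)
    with G have "(Poly_Mapping.single v 1 :: ('a extended, 'k) polys) \<in> ?G" by blast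
    then show "?gen v" by simp
  qed
next
  assume gen: "\<forall>v\<in>T_maps (join_irreducibles :: 'a set). ?gen v"
  show "?span = canonical_module"
  proof
    show "?span \<subseteq> canonical_module"
      by (rule module.span_minimal[OF module_hibi_scale _ canonical_module_subspace])
        (auto simp: canonical_module_degree_def)
    show "canonical_module \<subseteq> ?span"
    proof
      fix p :: "('a extended, 'k) polys"
      assume p: "p \<in> canonical_module"
      have "Poly_Mapping.single v (Poly_Mapping.lookup p v) \<in> ?span"
        if v: "v \<in> Poly_Mapping.keys p" for v
      proof -
        have "v \<in> T_maps join_irreducibles"
          using p v by (auto simp: canonical_module_def)
        then obtain v' w where v': "v' \<in> T_maps join_irreducibles" "Poly_Mapping.lookup v' Minf = d"
            "w \<in> S_maps join_irreducibles" "v = w + v'"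
          using gen by blast
        obtain r :: "('a, 'k) hibi_ring" where r: "hibi_embed r = Poly_Mapping.single w 1"
          using hibi_embed_onto_S_monomials[OF v'(3)] by blast
        have "Poly_Mapping.single v' (Poly_Mapping.lookup p v) \<in> canonical_module_degree d"
          using v'(1,2) by (simp add: canonical_module_degree_def canonical_module_def)
        then have "hibi_scale r (Poly_Mapping.single v' (Poly_Mapping.lookup p v)) \<in> ?span"
          by (intro module.span_scale[OF module_hibi_scale] module.span_base[OF module_hibi_scale])
        then show ?thesis
          by (simp add: hibi_scale_def r mult_single v'(4))
      qed
      then have "(\<Sum>v\<in>Poly_Mapping.keys p. Poly_Mapping.single v (Poly_Mapping.lookup p v)) \<in> ?span"
        by (intro module.span_sum[OF module_hibi_scale])
      moreover have "p = (\<Sum>v\<in>Poly_Mapping.keys p. Poly_Mapping.single v (Poly_Mapping.lookup p v))"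
        by (rule poly_mapping_eqI) (auto simp: lookup_sum lookup_single when_def in_keys_iff)
      ultimately show "p \<in> ?span" by simp
    qed
  qed
qed

section \<open>Exponent vectors as strictly order-reversing functions\<close>

lemma bounded_finite_poset_hat:
  fixes P :: "'b::order set"
  assumes "finite P"
  shows "bounded_finite_poset (hat P) Minf Pinf"
  using assms by unfold_locales (auto simp: hat_def)

lemma T_maps_strict_antitone:
  "v \<in> T_maps P \<Longrightarrow> strict_antitone_on (hat P) (Poly_Mapping.lookup v)"
  by (auto simp: T_maps_def strict_antitone_on_def)

text \<open>Setting \<open>f\<close> to 0 outside \<open>hat P\<close> provides the finite support
  that an exponent vector must have.\<close>

lemma strict_antitone_in_T_maps:
  fixes P :: "'b::order set"
  assumes "finite P" "strict_antitone_on (hat P) f" "f Pinf = 0"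
  obtains v where "v \<in> T_maps P" "\<And>z. z \<in> hat P \<Longrightarrow> Poly_Mapping.lookup v z = f z"
proof
  let ?v = "Abs_poly_mapping (\<lambda>z. if z \<in> hat P then f z else 0)"
  have "finite {z. (if z \<in> hat P then f z else 0) \<noteq> 0}"
    by (rule finite_subset[of _ "hat P"]) (simp_all add: hat_def assms(1) subset_iff)
  then have l: "Poly_Mapping.lookup ?v = (\<lambda>z. if z \<in> hat P then f z else 0)"
    by (rule lookup_Abs_poly_mapping)
  show "?v \<in> T_maps P"
    using assms(2,3) unfolding T_maps_def
    by (simp add: l strict_antitone_on_def in_keys_iff subset_iff)
  show "\<And>z. z \<in> hat P \<Longrightarrow> Poly_Mapping.lookup ?v z = f z"
    by (simp add: l)
qed

text \<open>\<open>level\<close> leaves the degree \<open>d\<close> open. Only the rank is possible: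
  the depth map has this degree, and a map from which it is generated has at most this degree and,
  like every map in \<open>T_maps\<close>, at least this degree.\<close>

lemma level_iff:
  "level TYPE('k::field) TYPE('a::{finite, distrib_lattice}) \<longleftrightarrow>
   (\<forall>v\<in>T_maps (join_irreducibles :: 'a set).
      \<exists>v'\<in>T_maps join_irreducibles. Poly_Mapping.lookup v' Minf = rank (P_hat :: 'a extended set) \<and>
        (\<exists>w\<in>S_maps join_irreducibles. v = w + v'))"
proof -
  interpret bounded_finite_poset "P_hat :: 'a extended set" Minf Pinf
    by (rule bounded_finite_poset_hat) simp
  obtain u where u: "u \<in> T_maps (join_irreducibles :: 'a set)"
      "\<And>z. z \<in> P_hat \<Longrightarrow> Poly_Mapping.lookup u z = depth P_hat z"
    using strict_antitone_in_T_maps[OF finite strict_antitone_on_depth depth_tp] by metis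
  then have u_Minf: "Poly_Mapping.lookup u Minf = rank (P_hat :: 'a extended set)"
    using depth_bt bt(1) by simp
  have "d = rank (P_hat :: 'a extended set)"
    if v': "v' \<in> T_maps join_irreducibles" "Poly_Mapping.lookup v' Minf = d" "u = w + v'" for d v' w
    using rank_le_strict_antitone_on[OF T_maps_strict_antitone[OF v'(1)]] v'(2,3) u_Minf
    by (simp add: lookup_add)
  then show ?thesis
    unfolding level_def span_canonical_module_degree_iff using u(1) by (metis (no_types, lifting))
qed

section \<open>Canonical decompositions into two chains\<close>

text \<open>An element below the least member of a maximal chain could be adjoined to the
  chain.\<close>

lemma maximal_chain_minimal_element:
  fixes P :: "'b::order set"
  assumes "finite P" "maximal_chain P C" "C \<noteq> {}"
  shows "\<exists>m\<in>C. \<forall>z\<in>P. \<not> z < m"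
proof -
  have C: "C \<subseteq> P" "Complete_Partial_Order.chain (\<le>) C"
    "\<And>D. D \<subseteq> P \<Longrightarrow> Complete_Partial_Order.chain (\<le>) D \<Longrightarrow> C \<subseteq> D \<Longrightarrow> D = C"
    using assms(2) by (auto simp: maximal_chain_def)
  obtain m where m: "m \<in> C" "\<And>z. z \<in> C \<Longrightarrow> z \<le> m \<Longrightarrow> m = z"
    using finite_has_minimal[OF finite_subset[OF C(1) assms(1)] assms(3)] by blast
  then have le: "m \<le> w" if "w \<in> C" for w
    using C(2) that unfolding chain_def by (metis order_refl)
  have "\<not> z < m" if "z \<in> P" for z
  proof
    assume z: "z < m"
    then have zC: "z < w" if "w \<in> C" for w
      using le[OF that] by (rule less_le_trans)
    then have "Complete_Partial_Order.chain (\<le>) (insert z C)"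
      using C(2) unfolding chain_def by (auto intro: less_imp_le)
    then have "insert z C = C"
      using C(1,3) that by blast
    then show False
      using zC by blast
  qed
  with m(1) show ?thesis by blast
qed

text \<open>Choose \<open>t\<close> maximal in \<open>B\<close> below \<open>u\<close>, then
  \<open>s\<close> minimal in \<open>A\<close> above \<open>t\<close>; an element strictly between
  them would contradict one of the choices.\<close>

lemma covers_between_blocks:
  fixes P :: "'b::order set"
  assumes "finite P" "P = A \<union> B"
    and chains: "Complete_Partial_Order.chain (\<le>) A" "Complete_Partial_Order.chain (\<le>) B"
    and "u \<in> A" "w \<in> B" "w < u"
  obtains s t where "s \<in> A" "t \<in> B" "covers_in P s t" "w \<le> t" "s \<le> u"
proof -
  obtain t where t: "t \<in> B" "t < u" "w \<le> t" "\<And>z. z \<in> B \<Longrightarrow> z < u \<Longrightarrow> t \<le> z \<Longrightarrow> t = z"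
    using finite_has_maximal2[of "{z \<in> B. z < u}" w] assms(1,2,6,7) by auto
  obtain s where s: "s \<in> A" "t < s" "s \<le> u" "\<And>z. z \<in> A \<Longrightarrow> t < z \<Longrightarrow> z \<le> s \<Longrightarrow> s = z"
    using finite_has_minimal2[of "{z \<in> A. t < z}" u] assms(1,2,5) t(2) by auto
  have "\<not> (t < z \<and> z < s)" if "z \<in> P" for z
  proof
    assume z: "t < z \<and> z < s"
    then have "z < u" using s(3) by (blast intro: less_le_trans)
    moreover have "z \<in> A \<or> z \<in> B" using that assms(2) by blast
    ultimately show False
      using z s(4)[of z] t(4)[of z] by (blast dest: less_imp_le less_imp_neq)
  qed
  then show thesis
    using that[of s t] s t assms(2) by (auto simp: covers_in_def)
qed

text \<open>Transfers the count of two blocks from some canonical decomposition to the given one. A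
  third block would give three pairwise incomparable minimal elements of \<open>P\<close>, two of
  which would share a chain of \<open>\<D>\<close>.\<close>

lemma canonical_chain_decomposition_two_blocks:
  fixes P :: "'b::order set"
  assumes P: "finite P"
    and \<D>: "canonical_chain_decomposition P \<D>" "card \<D> = 2"
    and \<C>: "canonical_chain_decomposition P \<C>" "A \<in> \<C>" "B \<in> \<C>" "A \<noteq> B"
  shows "\<C> = {A, B}"
proof (rule ccontr)
  assume "\<not> ?thesis"
  then obtain E where E: "E \<in> \<C>" "E \<noteq> A" "E \<noteq> B"
    using \<C>(2,3) by blast
  obtain D1 D2 where D: "\<D> = {D1, D2}"
    using \<D>(2) by (auto simp: card_2_iff)
  have "P = \<Union>\<D>" "\<And>F. F \<in> \<D> \<Longrightarrow> Complete_Partial_Order.chain (\<le>) F"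
    using \<D>(1)
    by (simp_all add: canonical_chain_decomposition_def partition_on_def maximal_chain_def)
  then have D: "P = D1 \<union> D2" "Complete_Partial_Order.chain (\<le>) D1"
      "Complete_Partial_Order.chain (\<le>) D2"
    by (simp_all add: \<open>\<D> = _\<close>)
  have min: "\<exists>m\<in>F. m \<in> P \<and> (\<forall>z\<in>P. \<not> z < m)" if "F \<in> \<C>" for F
  proof -
    have "maximal_chain P F" "F \<noteq> {}"
      using \<C>(1) that by (auto simp: canonical_chain_decomposition_def partition_on_def)
    moreover from this have "F \<subseteq> P"
      by (simp add: maximal_chain_def)
    ultimately show ?thesis
      using maximal_chain_minimal_element[OF P] by blast
  qed
  obtain a b e where m: "a \<in> A" "b \<in> B" "e \<in> E" "a \<in> P" "b \<in> P" "e \<in> P"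
      "\<forall>z\<in>P. \<not> z < a" "\<forall>z\<in>P. \<not> z < b" "\<forall>z\<in>P. \<not> z < e"
    using min[OF \<C>(2)] min[OF \<C>(3)] min[OF E(1)] by blast
  have "disjoint \<C>"
    using \<C>(1) by (simp add: canonical_chain_decomposition_def partition_on_def)
  then have "A \<inter> B = {}" "A \<inter> E = {}" "B \<inter> E = {}"
    using \<C>(2-4) E by (auto dest: disjointD)
  then have "a \<noteq> b" "a \<noteq> e" "b \<noteq> e"
    using m(1-3) by auto
  moreover have "p = q" if "p \<le> q \<or> q \<le> p" "p \<in> P" "q \<in> P" "\<forall>z\<in>P. \<not> z < p" "\<forall>z\<in>P. \<not> z < q" for p q
    using that by (auto simp: order_less_le)
  ultimately have "\<not> (a \<le> b \<or> b \<le> a)" "\<not> (a \<le> e \<or> e \<le> a)" "\<not> (b \<le> e \<or> e \<le> b)"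
    using m(4-9) by blast+
  moreover have "p \<le> q \<or> q \<le> p" if "p \<in> D1 \<and> q \<in> D1 \<or> p \<in> D2 \<and> q \<in> D2" for p q
    using D(2,3) that unfolding chain_def by blast
  ultimately show False
    using m(4-6) unfolding D(1) by blast
qed

text \<open>A comparability across the blocks encloses a covering relation across the blocks, which
  must be the single diagonal; this gives \<open>cross\<close>.\<close>

lemma single_diagonal_hat:
  fixes P :: "'b::order set"
  assumes P: "finite P"
    and \<D>: "canonical_chain_decomposition P \<D>" "card \<D> = 2"
    and \<C>: "canonical_chain_decomposition P \<C>" "diagonals P \<C> = {(x, y)}"
  obtains A B where "single_diagonal (hat P) Minf Pinf (Fin ` A) (Fin ` B) (Fin x) (Fin y)"
proof -
  have "(x, y) \<in> diagonals P \<C>"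
    using \<C>(2) by simp
  then obtain A B where AB: "A \<in> \<C>" "B \<in> \<C>" "A \<noteq> B" "x \<in> A" "y \<in> B" and yx: "y < x"
    by (auto simp: diagonals_def covers_in_def)
  have eq: "\<C> = {A, B}"
    by (rule canonical_chain_decomposition_two_blocks[OF P \<D> \<C>(1) AB(1-3)])
  have "P = \<Union>\<C>" "disjoint \<C>" "\<And>F. F \<in> \<C> \<Longrightarrow> Complete_Partial_Order.chain (\<le>) F"
    using \<C>(1)
    by (simp_all add: canonical_chain_decomposition_def partition_on_def maximal_chain_def)
  then have PAB: "P = A \<union> B" and AB_chains: "Complete_Partial_Order.chain (\<le>) A"
      "Complete_Partial_Order.chain (\<le>) B" and disj: "A \<inter> B = {}"
    using AB(1-3) eq disjointD[of \<C> A B] by simp_all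
  have cross: "w \<le> y \<and> x \<le> u" if uw: "u \<in> A" "w \<in> B" "u \<le> w \<or> w \<le> u" for u w
  proof -
    have "u \<noteq> w" using uw(1,2) disj by auto
    then consider "w < u" | "u < w" using uw(3) by (auto simp: order_less_le)
    then show ?thesis
    proof cases
      case 1
      then obtain s t where st: "s \<in> A" "t \<in> B" "covers_in P s t" "w \<le> t" "s \<le> u"
        using covers_between_blocks[OF P PAB AB_chains uw(1,2)] by blast
      then have "(s, t) \<in> diagonals P \<C>"
        using AB(1-3) by (auto simp: diagonals_def)
      with \<C>(2) st(4,5) show ?thesis by simp
    next
      \<comment> \<open>The enclosed covering relation would be a diagonal with upper element in
        \<open>B\<close>, whereas \<open>x\<close> lies in \<open>A\<close>.\<close>
      case 2
      then obtain s t where st: "s \<in> B" "t \<in> A" "covers_in P s t"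
        using covers_between_blocks[OF P _ AB_chains(2,1) uw(2,1)] PAB by (metis Un_commute)
      then have "(s, t) \<in> diagonals P \<C>"
        using AB(1-3) by (auto simp: diagonals_def)
      with \<C>(2) st(1) AB(4) disj show ?thesis by auto
    qed
  qed
  have "single_diagonal (hat P) Minf Pinf (Fin ` A) (Fin ` B) (Fin x) (Fin y)"
    using bounded_finite_poset_hat[OF P]
  proof (rule single_diagonal.intro)
    show "single_diagonal_axioms (hat P) Minf Pinf (Fin ` A) (Fin ` B) (Fin x) (Fin y)"
      using AB(4,5) AB_chains yx cross
      by unfold_locales (auto simp: hat_def PAB chain_def)
  qed
  then show thesis by (rule that)
qed

section \<open>Lowering exponent vectors, and the equivalences\<close>

text \<open>Subtracting the indicator of \<open>I\<close> narrows a gap only at steps out of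
  \<open>I\<close>, and there by 1, where the gap is at least 2.\<close>

lemma subtract_down_set_in_T_maps:
  fixes P :: "'b::order set"
  assumes P: "finite P" and v: "v \<in> T_maps P"
    and I: "I \<subseteq> hat P" "Minf \<in> I" "Pinf \<notin> I"
      "\<And>z w. z \<in> I \<Longrightarrow> w \<in> hat P \<Longrightarrow> w < z \<Longrightarrow> w \<in> I"
      "\<And>z w. z \<in> I \<Longrightarrow> w \<in> hat P \<Longrightarrow> w \<notin> I \<Longrightarrow> z < w \<Longrightarrow>
         Poly_Mapping.lookup v w + 2 \<le> Poly_Mapping.lookup v z"
  obtains v' w where "v' \<in> T_maps P" "w \<in> S_maps P" "v = w + v'"
    "Poly_Mapping.lookup v Minf = Poly_Mapping.lookup v' Minf + 1"
proof -
  let ?l = Poly_Mapping.lookup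
  define w :: "'b extended \<Rightarrow>\<^sub>0 nat" where "w = Abs_poly_mapping (\<lambda>z. if z \<in> I then 1 else 0)"
  have "finite (hat P)"
    using P by (simp add: hat_def)
  then have "finite I"
    using I(1) by (rule finite_subset[rotated])
  then have w: "?l w = (\<lambda>z. if z \<in> I then 1 else 0)"
    unfolding w_def by (intro lookup_Abs_poly_mapping) simp
  have anti: "?l v s < ?l v t" if "s \<in> hat P" "t \<in> hat P" "t < s" for s t
    using v that by (auto simp: T_maps_def)
  have hat: "Pinf \<in> hat P" "Minf \<in> hat P"
    by (auto simp: hat_def)
  \<comment> \<open>Since \<open>Pinf \<notin> I\<close>, \<open>v\<close> is positive on
    \<open>I\<close>, so the truncated subtraction of \<open>w\<close> is exact.\<close>
  have pos: "1 \<le> ?l v z" if "z \<in> I" for z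
    using anti[of Pinf z] that I(1,3) hat by (cases z) fastforce+
  then have eq: "v = w + (v - w)"
    by (intro poly_mapping_eqI) (simp add: lookup_add lookup_minus w)
  have "w \<in> S_maps P"
    unfolding S_maps_def
  proof (intro CollectI conjI ballI impI)
    show "Poly_Mapping.keys w \<subseteq> hat P" "?l w Pinf = 0"
      using I(1,3) by (auto simp: w in_keys_iff split: if_splits)
    fix s t assume st: "s \<in> hat P" "t \<in> hat P" "t \<le> s"
    show "?l w s \<le> ?l w t"
      using I(4)[of s t] st by (cases "t = s") (auto simp: w)
  qed
  moreover have "v - w \<in> T_maps P"
    unfolding T_maps_def
  proof (intro CollectI conjI ballI impI)
    show "Poly_Mapping.keys (v - w) \<subseteq> hat P" "?l (v - w) Pinf = 0"
      using v by (auto simp: T_maps_def in_keys_iff lookup_minus)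
    fix s t assume st: "s \<in> hat P" "t \<in> hat P" "t < s"
    show "?l (v - w) s < ?l (v - w) t"
      using anti[OF st] I(4)[of s t] I(5)[of t s] st pos[of s] pos[of t]
      by (auto simp: lookup_minus w)
  qed
  moreover have "?l v Minf = ?l (v - w) Minf + 1"
    using anti[of Pinf Minf] hat I(2) by (simp add: lookup_minus w)
  ultimately show thesis
    using that eq by blast
qed

theorem theorem4p8:
  fixes x y :: "'a::{finite, distrib_lattice}" and \<C> :: "'a set set"
  assumes "simple_planar TYPE('a)"
    and "canonical_chain_decomposition (join_irreducibles :: 'a set) \<C>"
    and "diagonals (join_irreducibles :: 'a set) \<C> = {(x, y)}"
  shows "(level TYPE('k::field) TYPE('a) \<longleftrightarrow>
            height P_hat (Fin x) + depth P_hat (Fin y) \<le> rank (P_hat :: 'a extended set) + 1) \<and>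
         (height P_hat (Fin x) + depth P_hat (Fin y) \<le> rank (P_hat :: 'a extended set) + 1 \<longleftrightarrow>
            depth P_hat (Fin y) = depth P_hat (Fin x) + 1 \<or>
            height P_hat (Fin x) = height P_hat (Fin y) + 1)"
proof -
  let ?J = "join_irreducibles :: 'a set" and ?l = Poly_Mapping.lookup
  let ?b = "height P_hat (Fin x) + depth P_hat (Fin y) \<le> rank (P_hat :: 'a extended set) + 1"
  obtain A B where "single_diagonal (hat ?J) Minf Pinf (Fin ` A) (Fin ` B) (Fin x) (Fin y)"
    using assms(1) single_diagonal_hat[OF finite _ _ assms(2,3)] unfolding simple_planar_def
    by blast
  then interpret single_diagonal "hat ?J" Minf Pinf "Fin ` A" "Fin ` B" "Fin x" "Fin y" .
  have "level TYPE('k) TYPE('a) \<longleftrightarrow> ?b"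
  proof
    assume level: "level TYPE('k) TYPE('a)"
    obtain v where v: "v \<in> T_maps ?J" "\<And>z. z \<in> P_hat \<Longrightarrow> ?l v z = lifted_depth (Fin x) (Fin y) z"
      using strict_antitone_in_T_maps[OF finite strict_antitone_on_lifted_depth[OF xy_Q(1)]
          lifted_depth_tp[OF xy_Q(1)]] by blast
    obtain v' w where v': "v' \<in> T_maps ?J" "?l v' Minf = rank (P_hat :: 'a extended set)"
        and w: "w \<in> S_maps ?J" "v = w + v'"
      using level v(1) unfolding level_iff by blast
    \<comment> \<open>Removing an order-reversing \<open>w\<close> cannot enlarge a drop, so from
      \<open>y\<close> to \<open>x\<close> the map \<open>v'\<close> drops by at most as much as
      \<open>lifted_depth\<close>.\<close>
    have "?l w (Fin x) \<le> ?l w (Fin y)"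
      using w(1) xy_Q less_imp_le[OF xy(3)] by (auto simp: S_maps_def)
    then have "?l v' (Fin y) + ?l v (Fin x) \<le> ?l v' (Fin x) + ?l v (Fin y)"
      by (simp add: w(2) lookup_add)
    then have "?l v' (Fin y) + lifted_depth (Fin x) (Fin y) (Fin x)
        \<le> ?l v' (Fin x) + lifted_depth (Fin x) (Fin y) (Fin y)"
      by (simp only: v(2) xy_Q)
    then show ?b
      by (intro lifted_depth_obstruction[OF covers_xy _ T_maps_strict_antitone[OF v'(1)] v'(2)]) simp
  next
    assume b: ?b
    \<comment> \<open>Induction on the degree down to the rank: each subtracted indicator lowers it
      by 1, and the subtracted maps add up within \<open>S_maps\<close>.\<close>
    have "\<exists>v'\<in>T_maps ?J. ?l v' Minf = rank (P_hat :: 'a extended set) \<and>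
        (\<exists>w\<in>S_maps ?J. v = w + v')" if "v \<in> T_maps ?J" for v
      using that
    proof (induction "?l v Minf" arbitrary: v rule: less_induct)
      case less
      show ?case
      proof (cases "?l v Minf = rank (P_hat :: 'a extended set)")
        case True
        then show ?thesis
          using less.prems S_maps_zero by (intro bexI[of _ v] conjI bexI[of _ 0]) auto
      next
        case False
        then have "rank (P_hat :: 'a extended set) < ?l v Minf"
          using rank_le_strict_antitone_on[OF T_maps_strict_antitone[OF less.prems]] by simp
        moreover have "?l v Pinf = 0"
          using less.prems by (simp add: T_maps_def)
        ultimately obtain I where I: "I \<subseteq> hat ?J" "Minf \<in> I" "Pinf \<notin> I"
          "\<And>z w. z \<in> I \<Longrightarrow> w \<in> hat ?J \<Longrightarrow> w < z \<Longrightarrow> w \<in> I"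
          "\<And>z w. z \<in> I \<Longrightarrow> w \<in> hat ?J \<Longrightarrow> w \<notin> I \<Longrightarrow> z < w \<Longrightarrow> ?l v w + 2 \<le> ?l v z"
          using ex_slack_down_set[OF T_maps_strict_antitone[OF less.prems] _ _ b] by blast
        obtain v1 w1 where v1: "v1 \<in> T_maps ?J" "w1 \<in> S_maps ?J" "v = w1 + v1"
            "?l v Minf = ?l v1 Minf + 1"
          by (rule subtract_down_set_in_T_maps[OF finite less.prems I])
        then obtain v' w where "v' \<in> T_maps ?J" "?l v' Minf = rank (P_hat :: 'a extended set)"
            "w \<in> S_maps ?J" "v1 = w + v'"
          using less.hyps[of v1] by auto
        then show ?thesis
          using v1(2,3) S_maps_add[of w1 _ w]
          by (intro bexI[of _ v'] conjI bexI[of _ "w1 + w"]) (simp_all add: add.assoc)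
      qed
    qed
    then show "level TYPE('k) TYPE('a)"
      unfolding level_iff by blast
  qed
  with height_add_depth_iff show ?thesis by blast
qed

end
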